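(* Let $1<p<\infty$, let $q=p/(p-1)$, and let $\widehat{p}=\max(p-1,1)$. Let $\omega$ be a real function analytic in a (complex) neighborhood of $[0,\infty)$ that is positive, non-increasing and non-constant on $[0,\infty)$. Suppose that $\lim_{r\to\infty}r^n\omega(r^2)=\lim_{r\to\infty}r^n\omega'(r^2)=0$ for all integers $n$, and that the polynomials are dense in $A^p_\infty(\omega(|z|^2))$ and in $A^q_\infty(\omega(|z|^2)-|z|^2\omega'(|z|^2))$. Let $k\in A^q_\infty(\omega(|z|^2))$ be nonzero and let $f$ be the extremal function in $A^p_\infty(\omega(|z|^2))$ for the integral kernel $k$. Then \[ D_p(\infty,f)\le\left[\frac{\widehat{p}}{\|k\|^*}\,D_q(\infty,k)\right]^{1/(p-1)} . \]
   Context: $dA$ is area measure on $\mathbb{C}$. For a nonnegative weight $\nu$ on $\mathbb{C}$, $A^p_\infty(\nu)$ is the space of entire functions $g$ with $\|g\|=\left(\int_{\mathbb{C}}|g|^p\nu\,dA\right)^{1/p}<\infty$. For $k\in A^q_\infty(\nu)$, $\Phi_k(g)=\int_{\mathbb{C}}g\,\overline{k}\,\nu\,dA$ is a bounded linear functional on $A^p_\infty(\nu)$, and $\|k\|^*$ is its operator norm. The extremal function for the kernel $k$ is the (unique) $f\in A^p_\infty(\nu)$ with $\|f\|=1$ and $\operatorname{Re}\Phi_k(f)=\sup\{\operatorname{Re}\Phi_k(g):\|g\|=1\}$. For an entire function $g$, $D_p(\infty,g)=\left(-\int_{\mathbb{C}}|z|^2|g(z)|^p\,\omega'(|z|^2)\,dA(z)\right)^{1/p}$.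 *)

theory Defs
  imports "HOL-Analysis.Analysis" "HOL-Computational_Algebra.Polynomial"
begin

definition Ap_space :: "real \<Rightarrow> (complex \<Rightarrow> real) \<Rightarrow> (complex \<Rightarrow> complex) set" where
  "Ap_space p \<nu> = {g. g holomorphic_on UNIV \<and>
      integrable lborel (\<lambda>z. norm (g z) powr p * \<nu> z)}"

definition Ap_norm :: "real \<Rightarrow> (complex \<Rightarrow> real) \<Rightarrow> (complex \<Rightarrow> complex) \<Rightarrow> real" where
  "Ap_norm p \<nu> g = (\<integral>z. norm (g z) powr p * \<nu> z \<partial>lborel) powr (1 / p)"

definition Phi :: "(complex \<Rightarrow> real) \<Rightarrow> (complex \<Rightarrow> complex) \<Rightarrow> (complex \<Rightarrow> complex) \<Rightarrow> complex" where
  "Phi \<nu> k g = (\<integral>z. g z * cnj (k z) * complex_of_real (\<nu> z) \<partial>lborel)"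

definition dual_norm :: "real \<Rightarrow> (complex \<Rightarrow> real) \<Rightarrow> (complex \<Rightarrow> complex) \<Rightarrow> real" where
  "dual_norm p \<nu> k = Sup {norm (Phi \<nu> k g) | g. g \<in> Ap_space p \<nu> \<and> Ap_norm p \<nu> g \<le> 1}"

definition is_extremal :: "real \<Rightarrow> (complex \<Rightarrow> real) \<Rightarrow> (complex \<Rightarrow> complex) \<Rightarrow> (complex \<Rightarrow> complex) \<Rightarrow> bool" where
  "is_extremal p \<nu> k f \<longleftrightarrow> f \<in> Ap_space p \<nu> \<and> Ap_norm p \<nu> f = 1 \<and>
     Re (Phi \<nu> k f) = Sup {Re (Phi \<nu> k g) | g. g \<in> Ap_space p \<nu> \<and> Ap_norm p \<nu> g = 1}"

definition polys_dense :: "real \<Rightarrow> (complex \<Rightarrow> real) \<Rightarrow> bool" where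
  "polys_dense p \<nu> \<longleftrightarrow> (\<forall>g \<in> Ap_space p \<nu>. \<forall>\<epsilon>>0. \<exists>P :: complex poly.
      poly P \<in> Ap_space p \<nu> \<and> Ap_norm p \<nu> (\<lambda>z. g z - poly P z) < \<epsilon>)"

definition analytic_near_halfline :: "(real \<Rightarrow> real) \<Rightarrow> bool" where
  "analytic_near_halfline \<omega> \<longleftrightarrow> (\<exists>U W. open U \<and> complex_of_real ` {0..} \<subseteq> U \<and>
      W holomorphic_on U \<and> (\<forall>x. complex_of_real x \<in> U \<longrightarrow> W (complex_of_real x) = complex_of_real (\<omega> x)))"

definition D_integrand :: "(real \<Rightarrow> real) \<Rightarrow> real \<Rightarrow> (complex \<Rightarrow> complex) \<Rightarrow> complex \<Rightarrow> real" where
  "D_integrand \<omega> p g z = - ((cmod z)^2 * norm (g z) powr p * deriv \<omega> ((cmod z)^2))"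

definition D_inf :: "(real \<Rightarrow> real) \<Rightarrow> real \<Rightarrow> (complex \<Rightarrow> complex) \<Rightarrow> real" where
  "D_inf \<omega> p g = (\<integral>z. D_integrand \<omega> p g z \<partial>lborel) powr (1 / p)"

end

theory Submission
  imports Defs "HOL-Complex_Analysis.Complex_Analysis" "HOL-Probability.Sinc_Integral"
begin

text \<open>
  Write \<open>\<nu>(z) = \<omega>(|z|\<^sup>2)\<close>, \<open>\<kappa>(z) = -|z|\<^sup>2 \<omega>'(|z|\<^sup>2)\<close>, \<open>\<Delta>\<^sub>s(z) = \<nu>(z) - \<nu>(z/s)\<close> and \<open>f\<^sub>r(z) = f(r z)\<close>, so
  that \<open>D\<^sub>p(\<infinity>,f)\<close> is the norm of \<open>f\<close> for the weight \<open>\<kappa>\<close>. Testing the extremal problem with \<open>f\<^sub>r\<close> gives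
  \<open>\<parallel>k\<parallel>\<^sup>* (1 - r \<parallel>f\<^sub>r\<parallel>) \<le> Re (\<Phi>\<^sub>k(f) - r \<Phi>\<^sub>k(f\<^sub>r))\<close>. Powers of \<open>z\<close> are orthogonal for radial weights, so
  \<open>r \<Phi>\<^sub>k(f\<^sub>r)\<close> is the pairing of \<open>f\<close> and \<open>k\<close> for the weight \<open>\<nu>(z/s)\<close> with \<open>s = \<surd>r\<close>, and by Hoelder's
  inequality the right-hand side is at most the product of the norms of \<open>f\<close> and \<open>k\<close> for \<open>\<Delta>\<^sub>s\<close>. Let
  \<open>A(s)\<close> be the \<open>p\<close>-th power of that norm of \<open>f\<close>. Since \<open>2\<kappa>\<close> is the derivative of \<open>\<nu>(z/s)\<close> at \<open>s = 1\<close> and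
  the circular means of \<open>|f|\<^sup>p\<close> increase with the radius, \<open>A(s) \<le> (1 - s\<^sup>2) D\<close> with \<open>D = D\<^sub>p(\<infinity>,f)\<^sup>p\<close>, and
  likewise for \<open>k\<close>. Moreover \<open>r \<parallel>f\<^sub>r\<parallel> = r\<^bsup>1-2/p\<^esup> (1 - A(r))\<^bsup>1/p\<^esup>\<close>. Dividing by \<open>1 - r\<close> first bounds
  \<open>A(r)/(1 - r)\<close>, so that \<open>D\<close> is finite by Fatou's lemma; letting \<open>r \<rightarrow> 1\<close> then yields
  \<open>2D + p - 2 \<le> p D\<^sub>q(\<infinity>,k) D\<^bsup>1/p\<^esup> / \<parallel>k\<parallel>\<^sup>*\<close>, which together with \<open>D \<ge> 1\<close> gives the claim.
\<close>

section \<open>Rotations and dilations of Lebesgue measure\<close>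

lemma borel_measurable_cis [measurable]: "cis \<in> borel_measurable borel"
  by (intro borel_measurable_continuous_onI continuous_intros)

lemma borel_measurable_cnj [measurable]: "cnj \<in> borel_measurable borel"
  by (intro borel_measurable_continuous_onI continuous_intros)

lemma borel_measurable_Complex [measurable (raw)]:
  "f \<in> borel_measurable M \<Longrightarrow> g \<in> borel_measurable M \<Longrightarrow> (\<lambda>x. Complex (f x) (g x)) \<in> borel_measurable M"
  by (simp add: borel_measurable_complex_iff)

lemma lborel_complex_eq_distr:
  "(lborel :: complex measure) = distr (lborel \<Otimes>\<^sub>M lborel) borel (\<lambda>(x, y). Complex x y)"
proof (rule lborel_eqI)
  fix l u :: complex
  assume "\<And>b. b \<in> Basis \<Longrightarrow> l \<bullet> b \<le> u \<bullet> b"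
  from this[of 1] this[of \<i>] have "Re l \<le> Re u" "Im l \<le> Im u"
    by (auto simp: Basis_complex_def)
  moreover have "(\<lambda>(x, y). Complex x y) -` box l u \<inter> space (lborel \<Otimes>\<^sub>M lborel)
      = {Re l <..< Re u} \<times> {Im l <..< Im u}"
    by (auto simp: in_box_complex_iff space_pair_measure)
  ultimately show "emeasure (distr (lborel \<Otimes>\<^sub>M lborel) borel (\<lambda>(x, y). Complex x y)) (box l u)
      = (\<Prod>b\<in>Basis. (u - l) \<bullet> b)"
    by (subst emeasure_distr)
       (auto simp: lborel.emeasure_pair_measure_Times Basis_complex_def ennreal_mult)
qed simp

lemma nn_integral_lborel_complex:
  fixes g :: "complex \<Rightarrow> ennreal"
  assumes [measurable]: "g \<in> borel_measurable borel"
  shows "(\<integral>\<^sup>+z. g z \<partial>lborel) = (\<integral>\<^sup>+x. \<integral>\<^sup>+y. g (Complex x y) \<partial>lborel \<partial>lborel)"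
    and "(\<integral>\<^sup>+z. g z \<partial>lborel) = (\<integral>\<^sup>+y. \<integral>\<^sup>+x. g (Complex x y) \<partial>lborel \<partial>lborel)"
proof -
  have "(\<integral>\<^sup>+z. g z \<partial>lborel) = (\<integral>\<^sup>+w. g (case w of (x, y) \<Rightarrow> Complex x y) \<partial>(lborel \<Otimes>\<^sub>M lborel))"
    by (subst lborel_complex_eq_distr) (simp add: nn_integral_distr)
  also have "\<dots> = (\<integral>\<^sup>+x. \<integral>\<^sup>+y. g (Complex x y) \<partial>lborel \<partial>lborel)"
    by (subst lborel.nn_integral_fst[symmetric]) (auto simp: split_beta')
  finally show inner_Im: "(\<integral>\<^sup>+z. g z \<partial>lborel) = (\<integral>\<^sup>+x. \<integral>\<^sup>+y. g (Complex x y) \<partial>lborel \<partial>lborel)" .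
  show "(\<integral>\<^sup>+z. g z \<partial>lborel) = (\<integral>\<^sup>+y. \<integral>\<^sup>+x. g (Complex x y) \<partial>lborel \<partial>lborel)"
    unfolding inner_Im by (rule lborel_pair.Fubini'[symmetric]) (simp add: split_beta')
qed

lemma nn_integral_lborel_shear:
  fixes g :: "complex \<Rightarrow> ennreal" and \<phi> :: "real \<Rightarrow> real"
  assumes [measurable]: "g \<in> borel_measurable borel" "\<phi> \<in> borel_measurable borel"
  shows "(\<integral>\<^sup>+z. g (z + of_real (\<phi> (Im z))) \<partial>lborel) = (\<integral>\<^sup>+z. g z \<partial>lborel)"
    and "(\<integral>\<^sup>+z. g (z + \<i> * of_real (\<phi> (Re z))) \<partial>lborel) = (\<integral>\<^sup>+z. g z \<partial>lborel)"
proof -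
  have translate: "(\<integral>\<^sup>+x. h (t + x) \<partial>lborel) = (\<integral>\<^sup>+x. h x \<partial>lborel)"
    if "h \<in> borel_measurable borel" for h :: "real \<Rightarrow> ennreal" and t
    using nn_integral_real_affine[OF that, of 1 t] by simp
  have "Complex x y + of_real (\<phi> y) = Complex (\<phi> y + x) y"
    "Complex x y + \<i> * of_real (\<phi> x) = Complex x (\<phi> x + y)" for x y
    by (simp_all add: complex_eq_iff)
  then show "(\<integral>\<^sup>+z. g (z + of_real (\<phi> (Im z))) \<partial>lborel) = (\<integral>\<^sup>+z. g z \<partial>lborel)"
    and "(\<integral>\<^sup>+z. g (z + \<i> * of_real (\<phi> (Re z))) \<partial>lborel) = (\<integral>\<^sup>+z. g z \<partial>lborel)"
    by (simp_all add: nn_integral_lborel_complex(2)[of "\<lambda>z. g (z + of_real (\<phi> (Im z)))"]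
          nn_integral_lborel_complex(1)[of "\<lambda>z. g (z + \<i> * of_real (\<phi> (Re z)))"]
          translate[where h = "\<lambda>x. g (Complex x _)"] translate[where h = "\<lambda>y. g (Complex _ y)"]
          flip: nn_integral_lborel_complex)
qed

lemma rotation_eq_shears:
  fixes d :: complex
  assumes unit: "cmod d = 1" and "d \<noteq> -1"
  defines "t \<equiv> Im d / (1 + Re d)"
  defines "H \<equiv> \<lambda>z. z + of_real (- t * Im z)" and "V \<equiv> \<lambda>z. z + \<i> * of_real (Im d * Re z)"
  shows "d * z = H (V (H z))"
proof -
  have squares: "(Re d)\<^sup>2 + (Im d)\<^sup>2 = 1" using unit by (simp add: cmod_def)
  have "1 + Re d \<noteq> 0"
    using squares \<open>d \<noteq> -1\<close> by (auto simp: complex_eq_iff add_eq_0_iff)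
  then have t: "t * (1 + Re d) = Im d" "1 - t * Im d = Re d"
    using squares by (simp_all add: t_def field_simps power2_eq_square)
  show ?thesis
  proof (rule complex_eqI)
    have "Re (H (V (H z))) = (1 - t * Im d) * Re z - t * (1 + (1 - t * Im d)) * Im z"
      by (simp add: H_def V_def algebra_simps)
    then show "Re (d * z) = Re (H (V (H z)))" by (simp only: t) simp
    have "Im (H (V (H z))) = Im d * Re z + (1 - t * Im d) * Im z"
      by (simp add: H_def V_def algebra_simps)
    then show "Im (d * z) = Im (H (V (H z)))" by (simp only: t) simp
  qed
qed

text \<open>Three shears do not reach the rotation by \<open>\<pi>\<close>, but every rotation is the square of another one.\<close>

lemma nn_integral_lborel_rotate:
  fixes g :: "complex \<Rightarrow> ennreal"
  assumes [measurable]: "g \<in> borel_measurable borel" and "cmod c = 1"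
  shows "(\<integral>\<^sup>+z. g (c * z) \<partial>lborel) = (\<integral>\<^sup>+z. g z \<partial>lborel)"
proof -
  have rotate: "(\<integral>\<^sup>+z. g (d * z) \<partial>lborel) = (\<integral>\<^sup>+z. g z \<partial>lborel)"
    if "cmod d = 1" "d \<noteq> -1" and [measurable]: "g \<in> borel_measurable borel"
    for d and g :: "complex \<Rightarrow> ennreal"
  proof -
    define H where "H z = z + of_real (- (Im d / (1 + Re d)) * Im z)" for z
    define V where "V z = z + \<i> * of_real (Im d * Re z)" for z
    have H: "(\<integral>\<^sup>+z. h (H z) \<partial>lborel) = (\<integral>\<^sup>+z. h z \<partial>lborel)"
      and V: "(\<integral>\<^sup>+z. h (V z) \<partial>lborel) = (\<integral>\<^sup>+z. h z \<partial>lborel)"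
      if "h \<in> borel_measurable borel" for h :: "complex \<Rightarrow> ennreal"
      unfolding H_def V_def using that by (intro nn_integral_lborel_shear; measurable)+
    have [measurable]: "H \<in> borel_measurable borel" "V \<in> borel_measurable borel"
      unfolding H_def V_def by measurable
    have "d * z = H (V (H z))" for z
      unfolding H_def V_def by (rule rotation_eq_shears[OF that(1,2)])
    then show ?thesis
      by (simp add: H[of "\<lambda>z. g (H (V z))"] V[of "\<lambda>z. g (H z)"] H[of g])
  qed
  define d where "d = csqrt c"
  have d: "d * d = c" "cmod d = 1"
    using assms(2) by (simp_all add: d_def flip: power2_eq_square)
  have "d \<noteq> -1" using csqrt_principal[of c] by (auto simp flip: d_def)
  have "(\<integral>\<^sup>+z. g (d * (d * z)) \<partial>lborel) = (\<integral>\<^sup>+z. g z \<partial>lborel)"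
    by (simp add: rotate[of d "\<lambda>z. g (d * z)"] rotate d \<open>d \<noteq> -1\<close>)
  then show ?thesis by (simp add: d(1) flip: mult.assoc)
qed

lemma distr_lborel_rotate:
  assumes "cmod c = 1"
  shows "distr lborel borel ((*) c) = (lborel :: complex measure)"
proof (rule measure_eqI)
  fix A assume "A \<in> sets (distr lborel borel ((*) c))"
  then have [measurable]: "A \<in> sets borel" by simp
  have "emeasure (distr lborel borel ((*) c)) A = (\<integral>\<^sup>+z. indicator A (c * z) \<partial>lborel)"
    by (simp flip: nn_integral_indicator add: nn_integral_distr)
  also have "\<dots> = emeasure lborel A"
    using assms by (simp add: nn_integral_lborel_rotate)
  finally show "emeasure (distr lborel borel ((*) c)) A = emeasure lborel A" .
qed simp

lemma integrable_lborel_rotate: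
  fixes g :: "complex \<Rightarrow> 'a::{banach, second_countable_topology}"
  assumes "integrable lborel g" "cmod c = 1"
  shows "integrable lborel (\<lambda>z. g (c * z))"
  using assms integrable_distr[of "(*) c" lborel borel g] by (simp add: distr_lborel_rotate)

lemma integral_lborel_rotate:
  fixes g :: "complex \<Rightarrow> 'a::{banach, second_countable_topology}"
  assumes [measurable]: "g \<in> borel_measurable borel" and "cmod c = 1"
  shows "(\<integral>z. g (c * z) \<partial>lborel) = (\<integral>z. g z \<partial>lborel)"
  using assms(2) integral_distr[of "(*) c" lborel borel g] by (simp add: distr_lborel_rotate)

lemma nn_integral_lborel_dilate:
  fixes g :: "'a::euclidean_space \<Rightarrow> ennreal"
  assumes [measurable]: "g \<in> borel_measurable borel" and "s > 0"
  shows "(\<integral>\<^sup>+x. g x \<partial>lborel) = ennreal (s ^ DIM('a)) * (\<integral>\<^sup>+x. g (s *\<^sub>R x) \<partial>lborel)"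
  using assms(2) by (subst lborel_affine[of s 0])
    (simp_all add: nn_integral_density nn_integral_distr nn_integral_cmult)

lemma integral_lborel_dilate:
  fixes g :: "'a::euclidean_space \<Rightarrow> 'b::{banach, second_countable_topology}"
  assumes [measurable]: "g \<in> borel_measurable borel" and "s > 0"
  shows "(\<integral>x. g x \<partial>lborel) = s ^ DIM('a) *\<^sub>R (\<integral>x. g (s *\<^sub>R x) \<partial>lborel)"
proof -
  have "(\<integral>x. g x \<partial>lborel) = (\<integral>x. g x \<partial>density (distr lborel borel (\<lambda>x. 0 + s *\<^sub>R x)) (\<lambda>_. \<bar>s\<bar> ^ DIM('a)))"
    using assms(2) by (subst lborel_affine[of s 0]) auto
  also have "\<dots> = (\<integral>x. s ^ DIM('a) *\<^sub>R g (s *\<^sub>R x) \<partial>lborel)"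
    using assms(2) by (subst integral_density) (auto simp: integral_distr)
  finally show ?thesis by simp
qed

section \<open>Means over the unit circle\<close>

lemma continuous_on_norm_powr [continuous_intros]:
  assumes "continuous_on A g" "p > 0"
  shows "continuous_on A (\<lambda>x. norm (g x) powr p)"
  using assms by (intro continuous_on_powr' continuous_intros) auto

definition circle_mean :: "(complex \<Rightarrow> 'a::real_normed_vector) \<Rightarrow> 'a" where
  "circle_mean \<phi> = integral {0..1} (\<lambda>t. \<phi> (cis (2 * pi * t)))"

lemma continuous_on_circle_param:
  assumes "continuous_on (sphere 0 1) \<phi>"
  shows "continuous_on A (\<lambda>t. \<phi> (cis (2 * pi * t)))"
  by (rule continuous_on_compose2[OF assms]) (auto intro!: continuous_intros)

lemma integrable_circle_param:
  fixes \<phi> :: "complex \<Rightarrow> 'a::banach"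
  assumes "continuous_on (sphere 0 1) \<phi>"
  shows "(\<lambda>t. \<phi> (cis (2 * pi * t))) integrable_on {a..b}"
  by (intro integrable_continuous_interval continuous_on_circle_param assms)

lemma circle_mean_of_real:
  fixes \<phi> :: "complex \<Rightarrow> real"
  assumes "continuous_on (sphere 0 1) \<phi>"
  shows "circle_mean (\<lambda>z. complex_of_real (\<phi> z)) = of_real (circle_mean \<phi>)"
  unfolding circle_mean_def
  by (intro integral_unique has_integral_of_real integrable_integral integrable_circle_param assms)

lemma integral_periodic_shift:
  fixes f :: "real \<Rightarrow> 'a::banach"
  assumes "continuous_on UNIV f" and periodic: "\<And>t. f (t + T) = f t" and a: "0 \<le> a" "a \<le> T"
  shows "integral {a..a + T} f = integral {0..T} f"
proof -
  have integrable: "f integrable_on {l..u}" for l u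
    by (rule integrable_continuous_interval) (rule continuous_on_subset[OF assms(1) subset_UNIV])
  have "f \<circ> (+) T = f" using periodic by (auto simp: o_def add.commute)
  then have "integral {T..a + T} f = integral {0..a} f"
    using integral_shift_Icc_real[of 0 a f T] by simp
  moreover have "integral {a..a + T} f = integral {a..T} f + integral {T..a + T} f"
    using a by (intro Henstock_Kurzweil_Integration.integral_combine[symmetric] integrable) auto
  moreover have "integral {0..T} f = integral {0..a} f + integral {a..T} f"
    using a by (intro Henstock_Kurzweil_Integration.integral_combine[symmetric] integrable) auto
  ultimately show ?thesis by simp
qed

lemma circle_mean_rotate:
  fixes \<phi> :: "complex \<Rightarrow> 'a::banach"
  assumes "continuous_on (sphere 0 1) \<phi>" and "cmod c = 1"
  shows "circle_mean (\<lambda>z. \<phi> (c * z)) = circle_mean \<phi>"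
proof -
  define a where "a = Arg2pi c / (2 * pi)"
  have a: "0 \<le> a" "a \<le> 1"
    using Arg2pi_ge_0[of c] Arg2pi_lt_2pi[of c] by (auto simp: a_def field_simps)
  have "c = cis (2 * pi * a)"
    using Arg2pi_eq[of c] assms(2) by (simp add: a_def cis_conv_exp mult.commute)
  then have "circle_mean (\<lambda>z. \<phi> (c * z)) = integral {0..1} ((\<lambda>t. \<phi> (cis (2 * pi * t))) \<circ> (+) a)"
    by (simp add: circle_mean_def o_def cis_mult distrib_left)
  also have "\<dots> = integral {a..a + 1} (\<lambda>t. \<phi> (cis (2 * pi * t)))"
    by (simp only: integral_shift_Icc_real add_0 add.commute)
  also have "\<dots> = circle_mean \<phi>"
    unfolding circle_mean_def
  proof (rule integral_periodic_shift[OF continuous_on_circle_param[OF assms(1)] _ a])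
    show "\<phi> (cis (2 * pi * (t + 1))) = \<phi> (cis (2 * pi * t))" for t
      using cis_mult[of "2 * pi * t" "2 * pi"] by (simp add: distrib_left)
  qed
  finally show ?thesis .
qed

lemma norm_circle_mean_mult_le:
  fixes u v :: "complex \<Rightarrow> complex"
  assumes u: "continuous_on (sphere 0 1) u" and v: "continuous_on (sphere 0 1) v"
    and pq: "p > 1" "q > 1" "1 / p + 1 / q = 1"
  shows "cmod (circle_mean (\<lambda>z. u z * v z))
    \<le> circle_mean (\<lambda>z. cmod (u z) powr p) / p + circle_mean (\<lambda>z. cmod (v z) powr q) / q"
proof -
  have integrable: "(\<lambda>t. cmod (w (cis (2 * pi * t))) powr r / r) integrable_on {0..1}"
    if "continuous_on (sphere 0 1) w" "r > 1" for w and r :: real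
    using that by (intro integrable_circle_param[where \<phi> = "\<lambda>z. cmod (w z) powr r / r"])
      (auto intro!: continuous_intros)
  have "cmod (circle_mean (\<lambda>z. u z * v z))
    \<le> integral {0..1} (\<lambda>t. cmod (u (cis (2 * pi * t))) powr p / p + cmod (v (cis (2 * pi * t))) powr q / q)"
    unfolding circle_mean_def
  proof (rule integral_norm_bound_integral)
    show "(\<lambda>t. u (cis (2 * pi * t)) * v (cis (2 * pi * t))) integrable_on {0..1}"
      by (intro integrable_circle_param[where \<phi> = "\<lambda>z. u z * v z"] continuous_intros u v)
    show "(\<lambda>t. cmod (u (cis (2 * pi * t))) powr p / p + cmod (v (cis (2 * pi * t))) powr q / q)
        integrable_on {0..1}"
      by (intro integrable_add integrable u v pq)
  qed (use Youngs_inequality[OF pq] in \<open>simp add: norm_mult\<close>)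
  also have "\<dots> = circle_mean (\<lambda>z. cmod (u z) powr p) / p + circle_mean (\<lambda>z. cmod (v z) powr q) / q"
    using integrable[OF u pq(1)] integrable[OF v pq(2)]
    by (simp add: circle_mean_def Henstock_Kurzweil_Integration.integral_add)
  finally show ?thesis .
qed

definition conj_powr :: "real \<Rightarrow> complex \<Rightarrow> complex" where
  "conj_powr a v = of_real (cmod v powr a) * cnj (sgn v)"

lemma norm_conj_powr: "cmod (conj_powr a v) = cmod v powr a"
  by (simp add: conj_powr_def norm_mult norm_sgn)

lemma mult_conj_powr: "v * conj_powr a v = of_real (cmod v powr (a + 1))"
proof (cases "v = 0")
  case False
  have "v * cnj (sgn v) = of_real (cmod v)"
    using False complex_norm_square[of v] by (simp add: sgn_eq power2_eq_square field_simps)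
  then show ?thesis using False by (simp add: conj_powr_def powr_add mult.left_commute)
qed (simp add: conj_powr_def)

lemma continuous_on_conj_powr [continuous_intros]:
  assumes "continuous_on A g" "a > 0"
  shows "continuous_on A (\<lambda>x. conj_powr a (g x))"
proof -
  have "isCont (conj_powr a) v" for v
  proof (cases "v = 0")
    case True
    have "isCont (\<lambda>v::complex. cmod v powr a) 0"
      using continuous_on_norm_powr[of UNIV "\<lambda>v::complex. v" a] assms(2)
      by (simp add: continuous_on_eq_continuous_at)
    then have "((\<lambda>v::complex. cmod v powr a) \<longlongrightarrow> 0) (at 0)"
      using assms(2) by (simp add: isCont_def)
    then have "(conj_powr a \<longlongrightarrow> 0) (at 0)"
      by (rule Lim_null_comparison[OF always_eventually, rotated]) (simp add: norm_conj_powr)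
    then show ?thesis by (simp add: isCont_def conj_powr_def True)
  next
    case False
    then show ?thesis unfolding conj_powr_def[abs_def] by (intro continuous_intros) auto
  qed
  then have "continuous_on UNIV (conj_powr a)" by (simp add: continuous_on_eq_continuous_at)
  from continuous_on_compose2[OF this assms(1)] show ?thesis by simp
qed

lemma continuous_on_entire_compose:
  assumes "g holomorphic_on UNIV" "continuous_on A h"
  shows "continuous_on A (\<lambda>x. g (h x))"
  using continuous_on_compose2[OF holomorphic_on_imp_continuous_on[OF assms(1)] assms(2)] by simp

lemma entire_scale:
  "g holomorphic_on UNIV \<Longrightarrow> (\<lambda>w. g (c * w)) holomorphic_on UNIV"
  using holomorphic_on_compose_gen[of "\<lambda>w. c * w" UNIV g UNIV]
  by (auto simp: o_def intro!: holomorphic_intros)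

lemma holomorphic_circle_mean:
  assumes g: "g holomorphic_on UNIV" and h: "continuous_on (sphere 0 1) h"
  shows "(\<lambda>\<zeta>. circle_mean (\<lambda>z. g (\<zeta> * z) * h z)) holomorphic_on UNIV"
proof -
  have "continuous_on (sphere 0 1) (\<lambda>z. g (\<zeta> * z) * h z)" for \<zeta>
    by (intro continuous_intros continuous_on_entire_compose[OF g] h)
  from integrable_circle_param[OF this, of _ 0 1]
  have "(\<lambda>t. g (\<zeta> * cis (2 * pi * t)) * h (cis (2 * pi * t))) integrable_on cbox 0 1" for \<zeta> by simp
  moreover have "((\<lambda>\<zeta>. g (\<zeta> * cis (2 * pi * t)) * h (cis (2 * pi * t))) has_field_derivative
      deriv g (\<zeta> * cis (2 * pi * t)) * cis (2 * pi * t) * h (cis (2 * pi * t))) (at \<zeta> within UNIV)" for \<zeta> t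
    by (rule derivative_eq_intros DERIV_chain2[OF holomorphic_derivI[OF g]] refl | simp)+
  moreover have "continuous_on (UNIV \<times> cbox 0 1)
      (\<lambda>(\<zeta>, t). deriv g (\<zeta> * cis (2 * pi * t)) * cis (2 * pi * t) * h (cis (2 * pi * t)))"
    unfolding split_beta'
    by (intro continuous_intros continuous_on_entire_compose[OF holomorphic_deriv[OF g open_UNIV]]
          continuous_on_compose2[OF h]) (auto intro!: continuous_intros)
  ultimately show ?thesis
    unfolding circle_mean_def by (subst box_real(2)[symmetric], intro leibniz_rule_holomorphic) auto
qed

text \<open>Pairing \<open>g(\<zeta> \<cdot>)\<close> with \<open>conj_powr (p - 1)\<close> of \<open>g(s \<cdot>)\<close> gives an entire function \<open>F\<close> of \<open>\<zeta>\<close>: Young's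
  inequality bounds \<open>F\<close> on the unit circle, and the maximum modulus principle carries the bound over to
  \<open>F(s)\<close>, which is the mean of \<open>|g(s \<cdot>)|\<^sup>p\<close>.\<close>

lemma circle_mean_norm_powr_mono:
  assumes g: "g holomorphic_on UNIV" and p: "p > 1" and s: "0 \<le> s" "s \<le> 1"
  shows "circle_mean (\<lambda>z. cmod (g (of_real s * z)) powr p) \<le> circle_mean (\<lambda>z. cmod (g z) powr p)"
proof -
  define q where "q = p / (p - 1)"
  have q: "q > 1" "1 / p + 1 / q = 1" "(p - 1) * q = p" using p by (auto simp: q_def field_simps)
  define I where "I \<zeta> = circle_mean (\<lambda>z. cmod (g (\<zeta> * z)) powr p)" for \<zeta>
  define h where "h z = conj_powr (p - 1) (g (of_real s * z))" for z
  define F where "F \<zeta> = circle_mean (\<lambda>z. g (\<zeta> * z) * h z)" for \<zeta>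
  have cont_h: "continuous_on A h" for A
    unfolding h_def using p by (intro continuous_intros continuous_on_entire_compose[OF g]) auto
  have F: "F holomorphic_on UNIV"
    unfolding F_def by (intro holomorphic_circle_mean g cont_h)
  have F_circle: "cmod (F \<zeta>) \<le> I 1 / p + I (of_real s) / q" if "cmod \<zeta> = 1" for \<zeta>
  proof -
    have "cmod (F \<zeta>) \<le> I \<zeta> / p + circle_mean (\<lambda>z. cmod (h z) powr q) / q"
      unfolding F_def I_def
      by (intro norm_circle_mean_mult_le continuous_intros continuous_on_entire_compose[OF g] cont_h p q)
    also have "I \<zeta> = I 1"
      unfolding I_def using p that
      by (subst circle_mean_rotate[where \<phi> = "\<lambda>z. cmod (g z) powr p"])
         (auto intro!: continuous_intros continuous_on_entire_compose[OF g])
    finally show ?thesis by (simp add: h_def I_def norm_conj_powr powr_powr q)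
  qed
  have "F (of_real s) = of_real (I (of_real s))"
    unfolding F_def I_def h_def mult_conj_powr using p
    by (subst circle_mean_of_real) (auto intro!: continuous_intros continuous_on_entire_compose[OF g])
  moreover have "cmod (F (of_real s)) \<le> I 1 / p + I (of_real s) / q"
  proof (rule maximum_modulus_frontier[where S = "cball 0 1" and f = F])
    show "F holomorphic_on interior (cball 0 1)" "continuous_on (closure (cball 0 1)) F"
      by (auto intro: holomorphic_on_imp_continuous_on holomorphic_on_subset[OF F])
  qed (use s F_circle in auto)
  ultimately have "I (of_real s) * (1 - 1 / q) \<le> I 1 / p" by (simp add: algebra_simps)
  moreover have "1 - 1 / q = 1 / p" using q by simp
  ultimately show ?thesis using p by (simp add: I_def field_simps)
qed

lemma contour_integral_circlepath_eq_circle_mean: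
  "contour_integral (circlepath 0 R) H
    = 2 * of_real pi * \<i> * circle_mean (\<lambda>z. of_real R * z * H (of_real R * z))"
proof -
  have "exp (2 * of_real pi * \<i> * of_real t) = cis (2 * pi * t)" for t
    by (simp add: cis_conv_exp mult_ac)
  then show ?thesis
    unfolding contour_integral_integral circle_mean_def integral_mult_right[symmetric]
    by (intro integral_cong) (simp only: vector_derivative_circlepath, simp add: circlepath)
qed

text \<open>On the circle of radius \<open>a\<close> the conjugate of \<open>K(b z)\<close> is a holomorphic function of \<open>w = a z\<close>
  depending only on \<open>a b\<close>, so the mean is a contour integral whose radius can be changed.\<close>

lemma circle_mean_mult_cnj_eq:
  assumes F: "F holomorphic_on UNIV" and K: "K holomorphic_on UNIV"
    and pos: "0 < a" "0 < a'" and product: "a * b = a' * b'"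
  shows "circle_mean (\<lambda>z. F (of_real a * z) * cnj (K (of_real b * z)))
       = circle_mean (\<lambda>z. F (of_real a' * z) * cnj (K (of_real b' * z)))"
proof -
  define H where "H w = F w * cnj (K (cnj (of_real (a * b) / w))) / w" for w
  have "(\<lambda>w. cnj (K (cnj w))) holomorphic_on UNIV"
    by (intro holomorphic_on_compose_cnj_cnj[of K UNIV, unfolded o_def] holomorphic_on_subset[OF K]) auto
  then have "(\<lambda>w. cnj (K (cnj (of_real (a * b) / w)))) holomorphic_on UNIV - {0}"
    by (rule holomorphic_on_compose_gen[rotated, unfolded o_def]) (auto intro!: holomorphic_intros)
  then have H: "H holomorphic_on UNIV - {0}"
    unfolding H_def by (intro holomorphic_intros holomorphic_on_subset[OF F]) auto
  have mean: "contour_integral (circlepath 0 r) H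
      = 2 * of_real pi * \<i> * circle_mean (\<lambda>z. F (of_real r * z) * cnj (K (of_real d * z)))"
    if "0 < r" "r * d = a * b" for r d
  proof -
    have "of_real r * z * H (of_real r * z) = F (of_real r * z) * cnj (K (of_real d * z))"
      if "cmod z = 1" for z
    proof -
      have "cnj (of_real (a * b) / (of_real r * z)) = of_real d * z"
        using that \<open>0 < r\<close> complex_norm_square[of z] unfolding \<open>r * d = a * b\<close>[symmetric]
        by (auto simp: divide_eq_eq mult_ac)
      moreover have "z \<noteq> 0" using that by auto
      ultimately show ?thesis using \<open>0 < r\<close> by (simp add: H_def del: complex_cnj_divide)
    qed
    then show ?thesis
      by (simp add: contour_integral_circlepath_eq_circle_mean circle_mean_def)
  qed
  have shift: "contour_integral (circlepath 0 r') H = contour_integral (circlepath 0 r) H"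
    if "0 < r" "r \<le> r'" for r r'
    using that by (intro contour_integral_circlepath_eq[OF open_UNIV H]) auto
  have "contour_integral (circlepath 0 a) H = contour_integral (circlepath 0 a') H"
    using shift[of a a'] shift[of a' a] pos by (cases "a \<le> a'") auto
  then show ?thesis using mean[of a b] mean[of a' b'] pos product by simp
qed

lemma circle_mean_power_mult_cnj:
  assumes K: "K holomorphic_on UNIV"
  shows "circle_mean (\<lambda>z. z ^ n * cnj (K z)) = cnj ((deriv ^^ n) K 0 / fact n)"
proof -
  have "((\<lambda>u. K u / (u - 0) ^ Suc n) has_contour_integral 2 * pi * \<i> / fact n * (deriv ^^ n) K 0)
      (circlepath 0 1)"
    by (rule Cauchy_has_contour_integral_higher_derivative_circlepath)
       (use K in \<open>auto intro: holomorphic_on_subset holomorphic_on_imp_continuous_on\<close>)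
  from contour_integral_unique[OF this]
  have "circle_mean (\<lambda>z. z * (K z / z ^ Suc n)) = (deriv ^^ n) K 0 / fact n"
    by (simp add: contour_integral_circlepath_eq_circle_mean field_simps)
  then have "cnj ((deriv ^^ n) K 0 / fact n) = circle_mean (\<lambda>z. cnj (z * (K z / z ^ Suc n)))"
    by (simp only: circle_mean_def flip: integral_cnj)
  also have "\<dots> = circle_mean (\<lambda>z. z ^ n * cnj (K z))"
    unfolding circle_mean_def
    by (intro integral_cong) (simp add: cis_cnj cis_mult divide_inverse mult_ac flip: power_inverse)
  finally show ?thesis by simp
qed

section \<open>Radial weights\<close>

definition radial :: "(complex \<Rightarrow> 'a) \<Rightarrow> bool" where
  "radial W \<longleftrightarrow> (\<forall>z w. cmod z = cmod w \<longrightarrow> W z = W w)"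

lemma radial_rotate: "radial W \<Longrightarrow> cmod c = 1 \<Longrightarrow> W (c * z) = W z"
  unfolding radial_def by (metis norm_mult mult_1)

lemma radial_compose: "radial W \<Longrightarrow> radial (\<lambda>z. h (W z))"
  unfolding radial_def by metis

lemma nn_integral_circle_mean:
  fixes \<phi> :: "complex \<Rightarrow> real" and W :: "complex \<Rightarrow> ennreal"
  assumes \<phi>: "continuous_on UNIV \<phi>" "\<And>z. 0 \<le> \<phi> z"
    and [measurable]: "W \<in> borel_measurable borel" and "radial W"
  shows "(\<integral>\<^sup>+z. ennreal (\<phi> z) * W z \<partial>lborel)
       = (\<integral>\<^sup>+z. ennreal (circle_mean (\<lambda>c. \<phi> (c * z))) * W z \<partial>lborel)"
proof -
  have [measurable]: "\<phi> \<in> borel_measurable borel" by (rule borel_measurable_continuous_onI[OF \<phi>(1)])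
  have circle: "(\<integral>\<^sup>+t. ennreal (\<phi> (cis (2 * pi * t) * z)) * indicator {0..1} t \<partial>lborel)
      = ennreal (circle_mean (\<lambda>c. \<phi> (c * z)))" for z
    unfolding circle_mean_def
    by (intro nn_integral_has_integral_lebesgue' integrable_integral \<phi>
          integrable_circle_param[where \<phi> = "\<lambda>c. \<phi> (c * z)"] continuous_on_compose2[OF \<phi>(1)])
       (auto intro!: continuous_intros)
  have rotate: "(\<integral>\<^sup>+z. ennreal (\<phi> (cis (2 * pi * t) * z)) * W z \<partial>lborel)
      = (\<integral>\<^sup>+z. ennreal (\<phi> z) * W z \<partial>lborel)" for t
    using nn_integral_lborel_rotate[of "\<lambda>z. ennreal (\<phi> z) * W z" "cis (2 * pi * t)"]
    by (simp add: radial_rotate[OF \<open>radial W\<close>])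
  have "(\<integral>\<^sup>+z. ennreal (\<phi> z) * W z \<partial>lborel)
      = (\<integral>\<^sup>+t. (\<integral>\<^sup>+z. ennreal (\<phi> (cis (2 * pi * t) * z)) * W z \<partial>lborel) * indicator {0..1::real} t \<partial>lborel)"
    by (simp add: rotate nn_integral_cmult)
  also have "\<dots> = (\<integral>\<^sup>+t. \<integral>\<^sup>+z. ennreal (\<phi> (cis (2 * pi * t) * z)) * indicator {0..1} t * W z \<partial>lborel \<partial>lborel)"
    by (intro nn_integral_cong, subst nn_integral_multc[symmetric]) (simp_all add: mult_ac)
  also have "\<dots> = (\<integral>\<^sup>+z. \<integral>\<^sup>+t. ennreal (\<phi> (cis (2 * pi * t) * z)) * indicator {0..1} t * W z \<partial>lborel \<partial>lborel)"
    by (rule lborel_pair.Fubini') (simp add: split_beta')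
  also have "\<dots> = (\<integral>\<^sup>+z. ennreal (circle_mean (\<lambda>c. \<phi> (c * z))) * W z \<partial>lborel)"
    by (simp add: nn_integral_multc circle)
  finally show ?thesis .
qed

lemma integral_circle_mean:
  fixes \<phi> W :: "complex \<Rightarrow> complex"
  assumes \<phi>: "continuous_on UNIV \<phi>" and [measurable]: "W \<in> borel_measurable borel" and "radial W"
    and integrable: "integrable lborel (\<lambda>z. \<phi> z * W z)"
  shows "(\<integral>z. \<phi> z * W z \<partial>lborel) = (\<integral>z. circle_mean (\<lambda>c. \<phi> (c * z)) * W z \<partial>lborel)"
proof -
  have [measurable]: "\<phi> \<in> borel_measurable borel" by (rule borel_measurable_continuous_onI[OF \<phi>])
  let ?h = "\<lambda>(t::real, z). indicator {0..1} t *\<^sub>R (\<phi> (cis (2 * pi * t) * z) * W z)"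
  have rotate: "integrable lborel (\<lambda>z. \<phi> (cis (2 * pi * t) * z) * W z)"
    "(\<integral>z. \<phi> (cis (2 * pi * t) * z) * W z \<partial>lborel) = (\<integral>z. \<phi> z * W z \<partial>lborel)"
    "(\<integral>z. cmod (\<phi> (cis (2 * pi * t) * z)) * cmod (W z) \<partial>lborel) = (\<integral>z. cmod (\<phi> z * W z) \<partial>lborel)" for t
    using integrable_lborel_rotate[OF integrable, of "cis (2 * pi * t)"]
      integral_lborel_rotate[of "\<lambda>z. \<phi> z * W z" "cis (2 * pi * t)"]
      integral_lborel_rotate[of "\<lambda>z. cmod (\<phi> z * W z)" "cis (2 * pi * t)"]
    by (simp_all add: radial_rotate[OF \<open>radial W\<close>] norm_mult)
  have circle: "(\<integral>t. ?h (t, z) \<partial>lborel) = circle_mean (\<lambda>c. \<phi> (c * z)) * W z" for z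
  proof -
    have "set_integrable lborel {0..1} (\<lambda>t. \<phi> (cis (2 * pi * t) * z) * W z)"
      by (intro borel_integrable_atLeastAtMost' continuous_intros continuous_on_compose2[OF \<phi>])
         (auto intro!: continuous_intros)
    from set_borel_integral_eq_integral(2)[OF this]
    show ?thesis
      by (simp only: set_lebesgue_integral_def circle_mean_def integral_mult_left case_prod_conv)
  qed
  have "integrable (lborel \<Otimes>\<^sub>M lborel) ?h"
    by (rule lborel_pair.Fubini_integrable) (auto simp: split_beta' norm_mult rotate)
  then have "(\<integral>z. \<integral>t. ?h (t, z) \<partial>lborel \<partial>lborel) = (\<integral>t. \<integral>z. ?h (t, z) \<partial>lborel \<partial>lborel)"
    by (intro lborel_pair.Fubini_integral) (simp add: split_beta')
  also have "\<dots> = (\<integral>z. \<phi> z * W z \<partial>lborel)"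
    by (simp add: rotate(2))
  finally show ?thesis by (simp only: circle)
qed

section \<open>Hoelder's inequality\<close>

lemma Youngs_inequality_scaled:
  fixes x y a b :: real
  assumes pq: "p > 1" "q > 1" "1 / p + 1 / q = 1" and "0 \<le> x" "0 \<le> y" and ab: "a > 0" "b > 0"
  shows "x * y \<le> a * b * (x powr p / (p * a powr p) + y powr q / (q * b powr q))"
proof -
  have "x / a * (y / b) \<le> (x / a) powr p / p + (y / b) powr q / q"
    using assms by (intro Youngs_inequality[OF pq]) auto
  also have "\<dots> = x powr p / (p * a powr p) + y powr q / (q * b powr q)"
    using assms by (simp add: powr_divide mult.commute)
  finally show ?thesis using ab by (simp add: pos_divide_le_eq mult_ac)
qed

lemma integrable_mult_conjugate:
  fixes f :: "'a \<Rightarrow> 'b::{banach, second_countable_topology}"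
    and g :: "'a \<Rightarrow> 'c::{banach, second_countable_topology}"
  assumes pq: "p > 1" "q > 1" "1 / p + 1 / q = 1"
    and [measurable]: "f \<in> borel_measurable M" "g \<in> borel_measurable M"
    and "integrable M (\<lambda>x. norm (f x) powr p)" "integrable M (\<lambda>x. norm (g x) powr q)"
  shows "integrable M (\<lambda>x. norm (f x) * norm (g x))"
proof (rule Bochner_Integration.integrable_bound)
  show "integrable M (\<lambda>x. norm (f x) powr p / p + norm (g x) powr q / q)"
    using assms by simp
  show "AE x in M. norm (norm (f x) * norm (g x)) \<le> norm (norm (f x) powr p / p + norm (g x) powr q / q)"
    by (intro AE_I2) (simp add: order_trans[OF Youngs_inequality[OF pq] abs_ge_self] abs_mult)
qed measurable

lemma Holder_inequality:
  fixes f :: "'a \<Rightarrow> 'b::{banach, second_countable_topology}"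
    and g :: "'a \<Rightarrow> 'c::{banach, second_countable_topology}"
  assumes pq: "p > 1" "q > 1" "1 / p + 1 / q = 1"
    and [measurable]: "f \<in> borel_measurable M" "g \<in> borel_measurable M"
    and f: "integrable M (\<lambda>x. norm (f x) powr p)" and g: "integrable M (\<lambda>x. norm (g x) powr q)"
  shows "(\<integral>x. norm (f x) * norm (g x) \<partial>M)
      \<le> (\<integral>x. norm (f x) powr p \<partial>M) powr (1 / p) * (\<integral>x. norm (g x) powr q \<partial>M) powr (1 / q)"
proof -
  define U where "U = (\<integral>x. norm (f x) powr p \<partial>M)"
  define V where "V = (\<integral>x. norm (g x) powr q \<partial>M)"
  have "(\<integral>x. norm (f x) * norm (g x) \<partial>M) \<le> U powr (1 / p) * V powr (1 / q)"
  proof (cases "U = 0 \<or> V = 0")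
    case True
    then have "AE x in M. norm (f x) * norm (g x) = 0"
      using integral_nonneg_eq_0_iff_AE[OF f] integral_nonneg_eq_0_iff_AE[OF g]
      by (auto simp: U_def V_def elim: eventually_mono)
    then have "(\<integral>x. norm (f x) * norm (g x) \<partial>M) = 0" by (rule integral_eq_zero_AE)
    then show ?thesis by simp
  next
    case False
    then have pos: "U > 0" "V > 0"
      by (auto simp: U_def V_def less_le Bochner_Integration.integral_nonneg)
    define a where "a = U powr (1 / p)"
    define b where "b = V powr (1 / q)"
    have ab: "a > 0" "b > 0" "a powr p = U" "b powr q = V"
      using pos pq by (auto simp: a_def b_def powr_powr)
    have "norm (f x) * norm (g x)
        \<le> a * b * (norm (f x) powr p / (p * U) + norm (g x) powr q / (q * V))" for x
      using Youngs_inequality_scaled[OF pq norm_ge_zero norm_ge_zero ab(1,2), of "f x" "g x"]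
      by (simp add: ab)
    then have "(\<integral>x. norm (f x) * norm (g x) \<partial>M)
        \<le> (\<integral>x. a * b * (norm (f x) powr p / (p * U) + norm (g x) powr q / (q * V)) \<partial>M)"
      using f g by (intro integral_mono integrable_mult_conjugate[OF pq]) auto
    also have "\<dots> = a * b * (U / (p * U) + V / (q * V))"
      using f g by (simp add: U_def V_def)
    also have "\<dots> = a * b" using pos pq by simp
    finally show ?thesis by (simp add: a_def b_def)
  qed
  then show ?thesis by (simp add: U_def V_def)
qed

section \<open>Weighted spaces of entire functions\<close>

definition weight :: "(complex \<Rightarrow> real) \<Rightarrow> bool" where
  "weight W \<longleftrightarrow> W \<in> borel_measurable borel \<and> (\<forall>z. 0 \<le> W z)"

definition Ap_mass :: "real \<Rightarrow> (complex \<Rightarrow> real) \<Rightarrow> (complex \<Rightarrow> complex) \<Rightarrow> real" where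
  "Ap_mass p W g = (\<integral>z. norm (g z) powr p * W z \<partial>lborel)"

lemma weightD:
  assumes "weight W"
  shows "W \<in> borel_measurable borel" "0 \<le> W z"
  using assms by (auto simp: weight_def)

lemma weight_divide:
  assumes "weight W"
  shows "weight (\<lambda>z. W (z / c))"
proof -
  note [measurable] = weightD(1)[OF assms]
  show ?thesis by (simp add: weight_def weightD(2)[OF assms])
qed

lemma Ap_norm_eq_Ap_mass_powr: "Ap_norm p W g = Ap_mass p W g powr (1 / p)"
  by (simp add: Ap_norm_def Ap_mass_def)

lemma Ap_mass_nonneg: "weight W \<Longrightarrow> 0 \<le> Ap_mass p W g"
  by (simp add: Ap_mass_def Bochner_Integration.integral_nonneg weightD)

lemma borel_measurable_entire: "g holomorphic_on UNIV \<Longrightarrow> g \<in> borel_measurable borel"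
  by (intro borel_measurable_continuous_onI holomorphic_on_imp_continuous_on)

lemma Ap_spaceD:
  assumes "g \<in> Ap_space p W"
  shows "g holomorphic_on UNIV" "g \<in> borel_measurable borel"
    and "integrable lborel (\<lambda>z. norm (g z) powr p * W z)"
  using assms by (auto simp: Ap_space_def borel_measurable_entire)

lemma nn_integral_eq_Ap_mass:
  assumes "weight W" "g \<in> Ap_space p W"
  shows "(\<integral>\<^sup>+z. ennreal (norm (g z) powr p * W z) \<partial>lborel) = ennreal (Ap_mass p W g)"
  unfolding Ap_mass_def using assms by (intro nn_integral_eq_integral Ap_spaceD) (auto simp: weightD)

lemma Ap_space_nn_integral_le:
  assumes W: "weight W" and h: "h holomorphic_on UNIV" and "0 \<le> c"
    and mass_le: "(\<integral>\<^sup>+z. ennreal (norm (h z) powr p * W z) \<partial>lborel) \<le> ennreal c"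
  shows "h \<in> Ap_space p W" and "Ap_mass p W h \<le> c"
proof -
  note [measurable] = weightD(1)[OF W] borel_measurable_entire[OF h]
  have "integrable lborel (\<lambda>z. norm (h z) powr p * W z)"
    using le_less_trans[OF mass_le] by (intro integrableI_bounded) (auto simp: abs_mult weightD(2)[OF W])
  with h show space: "h \<in> Ap_space p W" by (simp add: Ap_space_def)
  show "Ap_mass p W h \<le> c"
    using mass_le \<open>0 \<le> c\<close> by (simp add: nn_integral_eq_Ap_mass[OF W space])
qed

lemma Ap_space_weight_mono:
  assumes V: "weight V" and "\<And>z. V z \<le> W z" and g: "g \<in> Ap_space p W"
  shows "g \<in> Ap_space p V" and "Ap_mass p V g \<le> Ap_mass p W g"
proof -
  note [measurable] = weightD(1)[OF V] Ap_spaceD(2)[OF g]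
  have pointwise_le: "norm (g z) powr p * V z \<le> norm (g z) powr p * W z" for z
    using assms(2) by (intro mult_left_mono) auto
  then have integrable: "integrable lborel (\<lambda>z. norm (g z) powr p * V z)"
    by (intro Bochner_Integration.integrable_bound[OF Ap_spaceD(3)[OF g]])
       (auto simp: abs_mult weightD(2)[OF V] intro!: mult_left_mono order_trans[OF assms(2) abs_ge_self])
  with g show "g \<in> Ap_space p V" by (simp add: Ap_space_def)
  show "Ap_mass p V g \<le> Ap_mass p W g"
    unfolding Ap_mass_def by (intro integral_mono integrable Ap_spaceD(3)[OF g] pointwise_le)
qed

lemma Ap_mass_weight_diff:
  assumes "g \<in> Ap_space p W" "g \<in> Ap_space p V"
  shows "Ap_mass p (\<lambda>z. W z - V z) g = Ap_mass p W g - Ap_mass p V g"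
  unfolding Ap_mass_def right_diff_distrib
  by (intro Bochner_Integration.integral_diff Ap_spaceD(3) assms)

lemma Ap_space_cmult:
  assumes "g \<in> Ap_space p W"
  shows "(\<lambda>z. c * g z) \<in> Ap_space p W"
  using assms by (auto simp: Ap_space_def norm_mult powr_mult mult.assoc intro!: holomorphic_intros)

lemma Ap_norm_cmult:
  assumes "weight W" "p > 0"
  shows "Ap_norm p W (\<lambda>z. c * g z) = cmod c * Ap_norm p W g"
proof -
  have "Ap_mass p W (\<lambda>z. c * g z) = cmod c powr p * Ap_mass p W g"
    by (simp add: Ap_mass_def norm_mult powr_mult mult.assoc)
  then show ?thesis
    using assms by (simp add: Ap_norm_eq_Ap_mass_powr powr_mult powr_powr Ap_mass_nonneg)
qed

lemma Phi_cmult: "Phi W k (\<lambda>z. c * g z) = c * Phi W k g"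
  unfolding Phi_def by (simp add: mult.assoc)

lemma Phi_weight_diff:
  assumes "integrable lborel (\<lambda>z. g z * cnj (k z) * of_real (W z))"
    and "integrable lborel (\<lambda>z. g z * cnj (k z) * of_real (V z))"
  shows "Phi (\<lambda>z. W z - V z) k g = Phi W k g - Phi V k g"
  unfolding Phi_def of_real_diff right_diff_distrib
  by (intro Bochner_Integration.integral_diff assms)

lemma Phi_Holder:
  assumes pq: "p > 1" "q > 1" "1 / p + 1 / q = 1"
    and W: "weight W" and g: "g \<in> Ap_space p W" and k: "k \<in> Ap_space q W"
  shows "integrable lborel (\<lambda>z. g z * cnj (k z) * of_real (W z))"
    and "cmod (Phi W k g) \<le> Ap_norm p W g * Ap_norm q W k"
proof -
  note [measurable] = weightD(1)[OF W] Ap_spaceD(2)[OF g] Ap_spaceD(2)[OF k]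
  note nonneg [simp] = weightD(2)[OF W]
  note density = integrable_density[of _ lborel W] integral_density[of _ lborel W]
  let ?M = "density lborel (\<lambda>z. ennreal (W z))"
  have norm_eq: "norm (g z * cnj (k z) * of_real (W z)) = W z * (cmod (g z) * cmod (k z))" for z
    by (simp add: norm_mult)
  have "integrable ?M (\<lambda>z. cmod (g z) powr p)" "integrable ?M (\<lambda>z. cmod (k z) powr q)"
    using Ap_spaceD(3)[OF g] Ap_spaceD(3)[OF k] by (simp_all add: density mult.commute)
  note integrable_mult = integrable_mult_conjugate[OF pq _ _ this]
    and Holder = Holder_inequality[OF pq _ _ this]
  have "integrable lborel (\<lambda>z. W z * (cmod (g z) * cmod (k z)))"
    using integrable_mult by (simp add: density)
  then show "integrable lborel (\<lambda>z. g z * cnj (k z) * of_real (W z))"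
    by (subst integrable_norm_iff[symmetric]) (simp_all only: norm_eq, measurable)
  have "cmod (Phi W k g) \<le> (\<integral>z. W z * (cmod (g z) * cmod (k z)) \<partial>lborel)"
    unfolding Phi_def norm_eq[symmetric] by (rule integral_norm_bound)
  also have "\<dots> \<le> Ap_norm p W g * Ap_norm q W k"
    using Holder by (simp add: density Ap_norm_def mult.commute)
  finally show "cmod (Phi W k g) \<le> Ap_norm p W g * Ap_norm q W k" .
qed

lemma Ap_mass_dilate:
  assumes "weight W" and g: "g holomorphic_on UNIV" and "s > 0"
  shows "s\<^sup>2 * Ap_mass p W (\<lambda>z. g (of_real s * z)) = Ap_mass p (\<lambda>z. W (z / of_real s)) g"
proof -
  note [measurable] = weightD(1)[OF assms(1)] borel_measurable_entire[OF g]
  show ?thesis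
    unfolding Ap_mass_def using \<open>s > 0\<close>
    by (subst (2) integral_lborel_dilate[OF _ \<open>s > 0\<close>]) (simp_all add: scaleR_conv_of_real)
qed

lemma Phi_dilate:
  assumes "weight W" and f: "f holomorphic_on UNIV" and k: "k holomorphic_on UNIV" and "s > 0"
  shows "of_real (s\<^sup>2) * Phi W (\<lambda>z. k (of_real s * z)) (\<lambda>z. f (of_real s * z))
    = Phi (\<lambda>z. W (z / of_real s)) k f"
proof -
  note [measurable] = weightD(1)[OF assms(1)] borel_measurable_entire[OF f] borel_measurable_entire[OF k]
  show ?thesis
    unfolding Phi_def using \<open>s > 0\<close>
    by (subst (2) integral_lborel_dilate[OF _ \<open>s > 0\<close>]) (simp_all add: scaleR_conv_of_real)
qed

lemma nn_integral_norm_powr_dilate_le: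
  assumes g: "g holomorphic_on UNIV" and p: "p > 1" and s: "0 \<le> s" "s \<le> 1"
    and W: "weight W" "radial W"
  shows "(\<integral>\<^sup>+z. ennreal (norm (g (of_real s * z)) powr p * W z) \<partial>lborel)
       \<le> (\<integral>\<^sup>+z. ennreal (norm (g z) powr p * W z) \<partial>lborel)"
proof -
  note [measurable] = weightD(1)[OF W(1)]
  have mean: "(\<integral>\<^sup>+z. ennreal (norm (h z) powr p * W z) \<partial>lborel)
     = (\<integral>\<^sup>+z. ennreal (circle_mean (\<lambda>c. norm (h (c * z)) powr p)) * ennreal (W z) \<partial>lborel)"
    if h: "h holomorphic_on UNIV" for h
    using p by (subst nn_integral_circle_mean[symmetric])
      (auto simp: ennreal_mult' radial_compose[OF W(2)]
        intro!: continuous_intros holomorphic_on_imp_continuous_on h)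
  have "circle_mean (\<lambda>c. norm (g (of_real s * (c * z))) powr p)
      \<le> circle_mean (\<lambda>c. norm (g (c * z)) powr p)" for z
    using circle_mean_norm_powr_mono[OF entire_scale[OF g, of z] p s] by (simp add: mult_ac)
  then show ?thesis
    unfolding mean[OF g] mean[OF entire_scale[OF g]]
    by (intro nn_integral_mono mult_right_mono ennreal_leI) auto
qed

lemma Ap_space_dilate:
  assumes g: "g \<in> Ap_space p W" and p: "p > 1" and s: "0 \<le> s" "s \<le> 1"
    and W: "weight W" "radial W"
  shows "(\<lambda>z. g (of_real s * z)) \<in> Ap_space p W"
    and "Ap_mass p W (\<lambda>z. g (of_real s * z)) \<le> Ap_mass p W g"
proof -
  have "(\<integral>\<^sup>+z. ennreal (norm (g (of_real s * z)) powr p * W z) \<partial>lborel) \<le> ennreal (Ap_mass p W g)"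
    using nn_integral_norm_powr_dilate_le[OF Ap_spaceD(1)[OF g] p s W]
    by (simp add: nn_integral_eq_Ap_mass[OF W(1) g])
  from Ap_space_nn_integral_le[OF W(1) entire_scale[OF Ap_spaceD(1)[OF g]] Ap_mass_nonneg[OF W(1)] this]
  show "(\<lambda>z. g (of_real s * z)) \<in> Ap_space p W"
    and "Ap_mass p W (\<lambda>z. g (of_real s * z)) \<le> Ap_mass p W g" .
qed

lemma nn_integral_weight_dilate_le:
  assumes g: "g \<in> Ap_space p W" and p: "p > 1" and s: "0 < s" "s \<le> 1"
    and W: "weight W" "radial W"
  shows "(\<integral>\<^sup>+z. ennreal (norm (g z) powr p * W (z / of_real s)) \<partial>lborel) \<le> ennreal (s\<^sup>2 * Ap_mass p W g)"
proof -
  note [measurable] = weightD(1)[OF W(1)] Ap_spaceD(2)[OF g]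
  have "(\<integral>\<^sup>+z. ennreal (norm (g z) powr p * W (z / of_real s)) \<partial>lborel)
      = ennreal (s\<^sup>2) * (\<integral>\<^sup>+z. ennreal (norm (g (of_real s * z)) powr p * W z) \<partial>lborel)"
    using s by (subst nn_integral_lborel_dilate[OF _ s(1)]) (simp_all add: scaleR_conv_of_real)
  also have "\<dots> \<le> ennreal (s\<^sup>2) * ennreal (Ap_mass p W g)"
    using nn_integral_norm_powr_dilate_le[OF Ap_spaceD(1)[OF g] p _ s(2) W] s
    by (intro mult_left_mono) (simp_all add: nn_integral_eq_Ap_mass[OF W(1) g])
  finally show ?thesis by (simp add: ennreal_mult')
qed

lemma Ap_space_weight_dilate:
  assumes g: "g \<in> Ap_space p W" and p: "p > 1" and s: "0 < s" "s \<le> 1"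
    and W: "weight W" "radial W"
  shows "g \<in> Ap_space p (\<lambda>z. W (z / of_real s))"
  using Ap_space_nn_integral_le(1)[OF weight_divide[OF W(1)] Ap_spaceD(1)[OF g] _
      nn_integral_weight_dilate_le[OF assms]]
  by (simp add: Ap_mass_nonneg[OF W(1)])

text \<open>By orthogonality of powers on circles, a dilation of \<open>f\<close> by \<open>s\<^sup>2\<close> can be shared equally between
  \<open>f\<close> and \<open>k\<close>; a substitution then moves it to the weight.\<close>

lemma Phi_dilate_eq_Phi_weight:
  assumes pq: "p > 1" "q > 1" "1 / p + 1 / q = 1" and W: "weight W" "radial W"
    and f: "f \<in> Ap_space p W" and k: "k \<in> Ap_space q W" and s: "0 < s" "s \<le> 1"
  shows "of_real (s\<^sup>2) * Phi W k (\<lambda>z. f (of_real (s\<^sup>2) * z)) = Phi (\<lambda>z. W (z / of_real s)) k f"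
proof -
  note entire = Ap_spaceD(1)[OF f] Ap_spaceD(1)[OF k]
  note [measurable] = weightD(1)[OF W(1)]
  have mean: "Phi W (\<lambda>z. k (of_real b * z)) (\<lambda>z. f (of_real a * z))
     = (\<integral>z. circle_mean (\<lambda>c. f (of_real a * z * c) * cnj (k (of_real b * z * c))) * of_real (W z) \<partial>lborel)"
    if "0 \<le> a" "a \<le> 1" "0 \<le> b" "b \<le> 1" for a b
    unfolding Phi_def
  proof (subst integral_circle_mean)
    show "integrable lborel (\<lambda>z. f (of_real a * z) * cnj (k (of_real b * z)) * of_real (W z))"
      using that by (intro Phi_Holder(1)[OF pq W(1)] Ap_space_dilate f k pq W)
    show "continuous_on UNIV (\<lambda>z. f (of_real a * z) * cnj (k (of_real b * z)))"
      by (intro continuous_intros continuous_on_entire_compose[OF entire(1)]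
            continuous_on_entire_compose[OF entire(2)])
  qed (simp_all add: radial_compose[OF W(2)] mult_ac)
  have "circle_mean (\<lambda>c. f (of_real (s\<^sup>2) * z * c) * cnj (k (of_real 1 * z * c)))
      = circle_mean (\<lambda>c. f (of_real s * z * c) * cnj (k (of_real s * z * c)))" for z
    using circle_mean_mult_cnj_eq[OF entire_scale[OF entire(1), of z] entire_scale[OF entire(2), of z],
        of "s\<^sup>2" s 1 s] s
    by (simp add: power2_eq_square mult_ac)
  then have "Phi W k (\<lambda>z. f (of_real (s\<^sup>2) * z)) = Phi W (\<lambda>z. k (of_real s * z)) (\<lambda>z. f (of_real s * z))"
    using mean[of "s\<^sup>2" 1] mean[of s s] s by (simp add: power_le_one)
  then show ?thesis using Phi_dilate[OF W(1) entire s(1)] by simp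
qed

lemma Phi_power:
  assumes W: "weight W" "radial W" and k: "k holomorphic_on UNIV"
    and integrable: "integrable lborel (\<lambda>z. z ^ n * cnj (k z) * of_real (W z))"
  shows "Phi W k (\<lambda>z. z ^ n)
    = of_real (\<integral>z. cmod z ^ (2 * n) * W z \<partial>lborel) * cnj ((deriv ^^ n) k 0 / fact n)"
proof -
  have mean: "circle_mean (\<lambda>c. (c * z) ^ n * cnj (k (c * z)))
      = of_real (cmod z ^ (2 * n)) * cnj ((deriv ^^ n) k 0 / fact n)" for z
  proof -
    have "circle_mean (\<lambda>c. (c * z) ^ n * cnj (k (c * z)))
        = z ^ n * circle_mean (\<lambda>c. c ^ n * cnj (k (z * c)))"
      unfolding circle_mean_def integral_mult_right[symmetric] by (simp add: power_mult_distrib mult_ac)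
    also have "\<dots> = z ^ n * cnj (z ^ n * (deriv ^^ n) k 0 / fact n)"
      using circle_mean_power_mult_cnj[OF entire_scale[OF k]]
        higher_deriv_compose_linear[OF k, of UNIV 0 z n]
      by simp
    also have "z ^ n * cnj (z ^ n) = of_real (cmod z ^ (2 * n))"
      by (simp only: power_mult of_real_power[of "(cmod z)\<^sup>2" n] complex_norm_square power_mult_distrib
            complex_cnj_power)
    then have "z ^ n * cnj (z ^ n * (deriv ^^ n) k 0 / fact n)
        = of_real (cmod z ^ (2 * n)) * cnj ((deriv ^^ n) k 0 / fact n)"
      by (simp only: complex_cnj_mult complex_cnj_divide times_divide_eq_right flip: mult.assoc)
    finally show ?thesis .
  qed
  note [measurable] = weightD(1)[OF W(1)]
  have "Phi W k (\<lambda>z. z ^ n)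
      = (\<integral>z. circle_mean (\<lambda>c. (c * z) ^ n * cnj (k (c * z))) * of_real (W z) \<partial>lborel)"
    unfolding Phi_def
    by (intro integral_circle_mean[where \<phi> = "\<lambda>z. z ^ n * cnj (k z)"] radial_compose[OF W(2)] integrable
          continuous_intros holomorphic_on_imp_continuous_on k) measurable
  also have "\<dots> = (\<integral>z. of_real (cmod z ^ (2 * n) * W z) * cnj ((deriv ^^ n) k 0 / fact n) \<partial>lborel)"
    unfolding mean by (simp add: mult_ac)
  finally show ?thesis by (simp only: integral_mult_left_zero integral_complex_of_real)
qed

section \<open>Rapidly decreasing weights\<close>

definition rapidly_decreasing :: "(complex \<Rightarrow> real) \<Rightarrow> bool" where
  "rapidly_decreasing W \<longleftrightarrow> (\<forall>m::nat. \<exists>C. \<forall>z. cmod z ^ m * W z \<le> C)"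

lemma integrable_prod_inverse_1_plus_square:
  "integrable lborel (\<lambda>x::'a::euclidean_space. \<Prod>b\<in>Basis. inverse (1 + (x \<bullet> b)\<^sup>2))"
proof (rule integrableI_bounded)
  have "(\<integral>\<^sup>+x. ennreal (norm (\<Prod>b\<in>Basis. inverse (1 + (x \<bullet> b)\<^sup>2))) \<partial>(lborel :: 'a measure))
      = (\<integral>\<^sup>+x. (\<Prod>b\<in>Basis. ennreal (inverse (1 + (x \<bullet> b)\<^sup>2))) \<partial>(lborel :: 'a measure))"
    by (simp add: abs_prod prod_ennreal)
  also have "\<dots> = (\<Prod>b\<in>(Basis :: 'a set). \<integral>\<^sup>+t. ennreal (inverse (1 + t\<^sup>2)) \<partial>lborel)"
    by (rule nn_integral_lborel_prod) auto
  also have "(\<integral>\<^sup>+t. ennreal (inverse (1 + (t::real)\<^sup>2)) \<partial>lborel) < \<infinity>"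
    using integrable_inverse_1_plus_square by (simp add: set_integrable_def integrable_iff_bounded)
  then have "(\<Prod>b\<in>(Basis :: 'a set). \<integral>\<^sup>+t. ennreal (inverse (1 + (t::real)\<^sup>2)) \<partial>lborel) < \<infinity>"
    by (simp add: power_less_top_ennreal)
  finally show "(\<integral>\<^sup>+x. ennreal (norm (\<Prod>b\<in>Basis. inverse (1 + (x \<bullet> b)\<^sup>2))) \<partial>(lborel :: 'a measure)) < \<infinity>" .
qed simp

lemma integrable_moment:
  assumes W: "weight W" "rapidly_decreasing W"
  shows "integrable lborel (\<lambda>z. cmod z ^ m * W z)"
proof -
  note [measurable] = weightD(1)[OF W(1)]
  obtain C where C: "\<And>j z. cmod z ^ j * W z \<le> C j"
    using W(2) unfolding rapidly_decreasing_def by metis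
  define E where "E = C m + 2 * C (m + 2) + C (m + 4)"
  have bound: "cmod z ^ m * W z \<le> E * (\<Prod>b\<in>Basis. inverse (1 + (z \<bullet> b)\<^sup>2))" for z
  proof -
    have "(1 + (Re z)\<^sup>2) * (1 + (Im z)\<^sup>2) \<le> (1 + (cmod z)\<^sup>2) * (1 + (cmod z)\<^sup>2)"
      by (intro mult_mono) (auto simp: cmod_power2)
    then have "cmod z ^ m * W z * ((1 + (Re z)\<^sup>2) * (1 + (Im z)\<^sup>2))
        \<le> cmod z ^ m * W z * ((1 + (cmod z)\<^sup>2) * (1 + (cmod z)\<^sup>2))"
      by (intro mult_left_mono) (auto simp: weightD(2)[OF W(1)])
    also have "\<dots> = cmod z ^ m * W z + 2 * (cmod z ^ (m + 2) * W z) + cmod z ^ (m + 4) * W z"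
      by (simp add: power_add algebra_simps power2_eq_square power4_eq_xxxx)
    also have "\<dots> \<le> E"
      using C[of z m] C[of z "m + 2"] C[of z "m + 4"] by (simp add: E_def)
    finally have "cmod z ^ m * W z * ((1 + (Re z)\<^sup>2) * (1 + (Im z)\<^sup>2)) \<le> E" .
    moreover have "0 < (1 + (Re z)\<^sup>2) * (1 + (Im z)\<^sup>2)"
      by (intro mult_pos_pos add_pos_nonneg) auto
    ultimately have "cmod z ^ m * W z \<le> E / ((1 + (Re z)\<^sup>2) * (1 + (Im z)\<^sup>2))"
      by (simp add: pos_le_divide_eq)
    then show ?thesis by (simp add: Basis_complex_def divide_inverse)
  qed
  show ?thesis
  proof (rule Bochner_Integration.integrable_bound)
    show "integrable lborel (\<lambda>z::complex. E * (\<Prod>b\<in>Basis. inverse (1 + (z \<bullet> b)\<^sup>2)))"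
      by (intro integrable_mult_right integrable_prod_inverse_1_plus_square)
    show "AE z in lborel. norm (cmod z ^ m * W z) \<le> norm (E * (\<Prod>b\<in>Basis. inverse (1 + (z \<bullet> b)\<^sup>2)))"
      using order_trans[OF bound abs_ge_self] weightD(2)[OF W(1)] by (intro AE_I2) simp
  qed measurable
qed

lemma power_in_Ap_space:
  assumes W: "weight W" "rapidly_decreasing W" and p: "p > 0"
  shows "(\<lambda>z. z ^ n) \<in> Ap_space p W"
proof -
  note [measurable] = weightD(1)[OF W(1)]
  define N where "N = n * nat \<lceil>p\<rceil>"
  have norm_powr_le: "cmod (z ^ n) powr p \<le> 1 + cmod z ^ N" for z
  proof (cases "cmod z \<le> 1")
    case True
    then have "cmod (z ^ n) powr p \<le> 1"
      using p by (intro powr_le1) (auto simp: norm_power power_le_one)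
    then show ?thesis by (simp add: add_increasing2)
  next
    case False
    then have "z \<noteq> 0" by auto
    have "cmod (z ^ n) powr p \<le> cmod (z ^ n) powr real (nat \<lceil>p\<rceil>)"
      using p False by (intro powr_mono) (auto simp: norm_power one_le_power)
    also have "\<dots> = cmod z ^ N"
      using \<open>z \<noteq> 0\<close> by (subst powr_realpow) (auto simp: N_def norm_power power_mult)
    finally show ?thesis by simp
  qed
  have "integrable lborel (\<lambda>z. cmod z ^ 0 * W z + cmod z ^ N * W z)"
    by (intro Bochner_Integration.integrable_add integrable_moment W)
  then have "integrable lborel (\<lambda>z. cmod (z ^ n) powr p * W z)"
  proof (rule Bochner_Integration.integrable_bound)
    show "AE z in lborel. norm (cmod (z ^ n) powr p * W z) \<le> norm (cmod z ^ 0 * W z + cmod z ^ N * W z)"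
      using mult_right_mono[OF norm_powr_le weightD(2)[OF W(1)]] weightD(2)[OF W(1)]
      by (intro AE_I2) (simp add: algebra_simps)
  qed measurable
  then show ?thesis by (auto simp: Ap_space_def intro!: holomorphic_intros)
qed

lemma Phi_power_neq_0:
  assumes pq: "p > 1" "q > 1" "1 / p + 1 / q = 1"
    and W: "weight W" "radial W" "rapidly_decreasing W" "\<And>z. W z > 0"
    and k: "k \<in> Ap_space q W" "k \<noteq> (\<lambda>z. 0)"
  obtains n where "Phi W k (\<lambda>z. z ^ n) \<noteq> 0"
proof -
  obtain n where n: "(deriv ^^ n) k 0 \<noteq> 0"
    using k(2) holomorphic_fun_eq_0_on_connected[OF Ap_spaceD(1)[OF k(1)], of 0] by auto
  have power: "(\<lambda>z. z ^ n) \<in> Ap_space p W" using pq(1) by (intro power_in_Ap_space W) auto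
  have "(\<integral>z. cmod z ^ (2 * n) * W z \<partial>lborel) \<noteq> 0"
  proof
    assume "(\<integral>z. cmod z ^ (2 * n) * W z \<partial>lborel) = 0"
    then have "AE z in lborel. cmod z ^ (2 * n) * W z = 0"
      using integral_nonneg_eq_0_iff_AE[OF integrable_moment[OF W(1,3)]] by (simp add: weightD(2)[OF W(1)])
    moreover have "AE z in (lborel :: complex measure). z \<noteq> 0" by (rule AE_lborel_singleton)
    ultimately have "AE z in (lborel :: complex measure). False"
      by eventually_elim (simp add: W(4)[THEN less_imp_neq, symmetric])
    then show False by (simp add: AE_iff_null null_sets_def)
  qed
  then have "Phi W k (\<lambda>z. z ^ n) \<noteq> 0"
    using n Phi_power[OF W(1,2) Ap_spaceD(1)[OF k(1)] Phi_Holder(1)[OF pq W(1) power k(1)]] by simp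
  then show ?thesis by (rule that)
qed

section \<open>The extremal problem\<close>

locale extremal_problem =
  fixes p q :: real and W :: "complex \<Rightarrow> real" and k f :: "complex \<Rightarrow> complex"
  assumes p: "p > 1" and q: "q = p / (p - 1)" and weight: "weight W"
    and k: "k \<in> Ap_space q W" and f: "is_extremal p W k f"
begin

lemma conjugate_exponents: "p > 1" "q > 1" "1 / p + 1 / q = 1"
  using p unfolding q by (auto simp: field_simps)

lemma f_space: "f \<in> Ap_space p W" and f_norm: "Ap_norm p W f = 1"
  using f by (auto simp: is_extremal_def)

lemma Ap_mass_f: "Ap_mass p W f = 1"
proof -
  have "(Ap_mass p W f powr (1 / p)) powr p = 1"
    using f_norm by (simp add: Ap_norm_eq_Ap_mass_powr)
  then show ?thesis using p Ap_mass_nonneg[OF weight, of p f] by (simp add: powr_powr)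
qed

lemma Re_Phi_le:
  assumes g: "g \<in> Ap_space p W"
  shows "Re (Phi W k g) \<le> Re (Phi W k f) * Ap_norm p W g"
proof (cases "Ap_norm p W g = 0")
  case True
  then show ?thesis
    using Phi_Holder(2)[OF conjugate_exponents weight g k] complex_Re_le_cmod[of "Phi W k g"] by simp
next
  case False
  define N where "N = Ap_norm p W g"
  have N: "N > 0" using False by (simp add: N_def Ap_norm_def)
  define h where "h = (\<lambda>z. of_real (inverse N) * g z)"
  have le_Ap_norm: "Re (Phi W k g) \<le> Ap_norm q W k" if "g \<in> Ap_space p W" "Ap_norm p W g = 1" for g
    using Phi_Holder(2)[OF conjugate_exponents weight that(1) k] complex_Re_le_cmod[of "Phi W k g"] that(2)
    by simp
  have "Re (Phi W k h) \<le> Sup {Re (Phi W k g) | g. g \<in> Ap_space p W \<and> Ap_norm p W g = 1}"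
  proof (rule cSup_upper)
    have "h \<in> Ap_space p W" unfolding h_def by (rule Ap_space_cmult[OF g])
    moreover have "Ap_norm p W h = 1"
      using N p by (simp add: h_def Ap_norm_cmult[OF weight] norm_inverse flip: N_def)
    ultimately show "Re (Phi W k h) \<in> {Re (Phi W k g) | g. g \<in> Ap_space p W \<and> Ap_norm p W g = 1}"
      by blast
    show "bdd_above {Re (Phi W k g) | g. g \<in> Ap_space p W \<and> Ap_norm p W g = 1}"
      using le_Ap_norm by (intro bdd_aboveI[of _ "Ap_norm q W k"]) auto
  qed
  also have "\<dots> = Re (Phi W k f)" using f by (simp add: is_extremal_def)
  also have "Re (Phi W k h) = Re (Phi W k g) / N"
    unfolding h_def Phi_cmult by (simp add: divide_inverse_commute del: of_real_inverse)
  finally show ?thesis using N by (simp add: pos_divide_le_eq flip: N_def)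
qed

lemma norm_Phi_le:
  assumes g: "g \<in> Ap_space p W"
  shows "cmod (Phi W k g) \<le> Re (Phi W k f) * Ap_norm p W g"
proof -
  define c where "c = cis (- Arg (Phi W k g))"
  have "c * Phi W k g = of_real (cmod (Phi W k g))"
    using rcis_cmod_Arg[of "Phi W k g"] unfolding c_def rcis_def
    by (metis cis_mult cis_zero mult.left_commute mult.right_neutral add.left_inverse)
  then have "cmod (Phi W k g) = Re (Phi W k (\<lambda>z. c * g z))" by (simp add: Phi_cmult)
  also have "\<dots> \<le> Re (Phi W k f) * Ap_norm p W (\<lambda>z. c * g z)"
    by (intro Re_Phi_le Ap_space_cmult g)
  also have "Ap_norm p W (\<lambda>z. c * g z) = Ap_norm p W g"
    using p by (simp add: Ap_norm_cmult[OF weight] c_def)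
  finally show ?thesis .
qed

lemma dual_norm_eq: "dual_norm p W k = Re (Phi W k f)"
  unfolding dual_norm_def
proof (rule cSup_eq_maximum)
  have "cmod (Phi W k f) = Re (Phi W k f)"
    using norm_Phi_le[OF f_space] complex_Re_le_cmod[of "Phi W k f"] by (simp add: f_norm)
  then show "Re (Phi W k f) \<in> {cmod (Phi W k g) | g. g \<in> Ap_space p W \<and> Ap_norm p W g \<le> 1}"
    using f_space f_norm by (intro CollectI exI[of _ f]) auto
next
  fix x assume "x \<in> {cmod (Phi W k g) | g. g \<in> Ap_space p W \<and> Ap_norm p W g \<le> 1}"
  then obtain g where g: "x = cmod (Phi W k g)" "g \<in> Ap_space p W" "Ap_norm p W g \<le> 1" by auto
  have "0 \<le> Re (Phi W k f)"
    using order_trans[OF norm_ge_zero norm_Phi_le[OF f_space]] by (simp add: f_norm)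
  from mult_left_mono[OF g(3) this] show "x \<le> Re (Phi W k f)"
    using norm_Phi_le[OF g(2)] g(1) by simp
qed

lemma norm_Phi_le_dual_norm:
  "g \<in> Ap_space p W \<Longrightarrow> cmod (Phi W k g) \<le> dual_norm p W k * Ap_norm p W g"
  by (simp add: norm_Phi_le dual_norm_eq)

lemma dual_norm_nonneg: "0 \<le> dual_norm p W k"
  using order_trans[OF norm_ge_zero norm_Phi_le_dual_norm[OF f_space]] by (simp add: f_norm)

lemma dual_norm_pos:
  assumes "radial W" "rapidly_decreasing W" "\<And>z. W z > 0" and "k \<noteq> (\<lambda>z. 0)"
  shows "0 < dual_norm p W k"
proof -
  obtain n where "Phi W k (\<lambda>z. z ^ n) \<noteq> 0"
    using Phi_power_neq_0[OF conjugate_exponents weight assms(1-3) k assms(4)] .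
  moreover have "cmod (Phi W k (\<lambda>z. z ^ n)) \<le> dual_norm p W k * Ap_norm p W (\<lambda>z. z ^ n)"
    using p by (intro norm_Phi_le_dual_norm power_in_Ap_space weight assms) auto
  ultimately have "dual_norm p W k \<noteq> 0" by auto
  then show ?thesis using dual_norm_nonneg by simp
qed

end

section \<open>Increments of a smooth radial weight\<close>

lemma analytic_near_halfline_deriv:
  assumes "analytic_near_halfline \<omega>"
  shows "\<And>x. x \<ge> 0 \<Longrightarrow> (\<omega> has_real_derivative deriv \<omega> x) (at x)"
    and "continuous_on {0..} (deriv \<omega>)"
proof -
  obtain U W where U: "open U" "complex_of_real ` {0..} \<subseteq> U" and W: "W holomorphic_on U"
    and W_eq: "\<And>x. complex_of_real x \<in> U \<Longrightarrow> W (complex_of_real x) = complex_of_real (\<omega> x)"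
    using assms unfolding analytic_near_halfline_def by blast
  have DERIV_Re: "(\<omega> has_real_derivative Re (deriv W (of_real x))) (at x)" if "x \<ge> 0" for x
  proof -
    have "(W has_field_derivative deriv W (of_real x)) (at (of_real x))"
      using that U by (intro holomorphic_derivI[OF W]) auto
    then have "((\<lambda>x. Re (W (of_real x))) has_real_derivative Re (deriv W (of_real x))) (at x)"
      by (intro has_field_derivative_Re has_vector_derivative_real_field)
    then show ?thesis
    proof (rule has_field_derivative_transform_within_open)
      show "open (complex_of_real -` U)" using U by (intro open_vimage continuous_intros) auto
    qed (use that U W_eq in auto)
  qed
  have deriv_eq: "deriv \<omega> x = Re (deriv W (of_real x))" if "x \<ge> 0" for x
    using DERIV_imp_deriv[OF DERIV_Re[OF that]] .
  show "(\<omega> has_real_derivative deriv \<omega> x) (at x)" if "x \<ge> 0" for x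
    using DERIV_Re deriv_eq that by simp
  have "continuous_on U (deriv W)"
    using W U by (intro holomorphic_on_imp_continuous_on holomorphic_deriv)
  then have "continuous_on {0..} (\<lambda>x. Re (deriv W (of_real x)))"
    using U(2) by (intro continuous_on_Re continuous_on_compose2[of U "deriv W" _ complex_of_real])
      (auto intro: continuous_intros)
  then show "continuous_on {0..} (deriv \<omega>)"
    using deriv_eq by (subst continuous_on_cong[OF refl, where g = "\<lambda>x. Re (deriv W (of_real x))"]) auto
qed

lemma DERIV_left_quotient:
  fixes F :: "real \<Rightarrow> real"
  assumes "(F has_real_derivative D) (at x)"
  shows "((\<lambda>s. (F x - F s) / (x - s)) \<longlongrightarrow> D) (at_left x)"
proof -
  have "((\<lambda>s. (F s - F x) / (s - x)) \<longlongrightarrow> D) (at_left x)"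
    using assms by (auto simp: has_field_derivative_iff
        intro: filterlim_at_split[THEN iffD1, THEN conjunct1])
  moreover have "(F s - F x) / (s - x) = (F x - F s) / (x - s)" for s
    using minus_divide_divide[of "F x - F s" "x - s"] by simp
  ultimately show ?thesis by simp
qed

locale smooth_radial_weight =
  fixes \<omega> :: "real \<Rightarrow> real"
  assumes DERIV_omega: "\<And>x. x \<ge> 0 \<Longrightarrow> (\<omega> has_real_derivative deriv \<omega> x) (at x)"
    and continuous_deriv_omega: "continuous_on {0..} (deriv \<omega>)"
    and omega_pos: "\<And>x. x \<ge> 0 \<Longrightarrow> \<omega> x > 0"
    and omega_antimono: "\<And>x y. 0 \<le> x \<Longrightarrow> x \<le> y \<Longrightarrow> \<omega> y \<le> \<omega> x"
begin

definition \<nu> :: "complex \<Rightarrow> real" where "\<nu> z = \<omega> ((cmod z)\<^sup>2)"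

definition \<kappa> :: "complex \<Rightarrow> real" where "\<kappa> z = - ((cmod z)\<^sup>2 * deriv \<omega> ((cmod z)\<^sup>2))"

definition \<Delta> :: "real \<Rightarrow> complex \<Rightarrow> real" where "\<Delta> s z = \<nu> z - \<nu> (z / of_real s)"

lemma nu_pos: "\<nu> z > 0"
  by (simp add: \<nu>_def omega_pos)

lemma weight_nu: "weight \<nu>"
proof -
  have "continuous_on {0..} \<omega>"
    by (rule DERIV_continuous_on[where D = "deriv \<omega>"])
       (auto intro: DERIV_omega has_field_derivative_at_within)
  then have "continuous_on UNIV (\<lambda>z::complex. \<omega> ((cmod z)\<^sup>2))"
    by (rule continuous_on_compose2) (auto intro!: continuous_intros)
  then show ?thesis
    using nu_pos
    by (simp add: weight_def \<nu>_def[abs_def] borel_measurable_continuous_onI omega_pos less_imp_le)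
qed

lemma deriv_omega_nonpos:
  assumes "x \<ge> 0"
  shows "deriv \<omega> x \<le> 0"
proof (rule ccontr)
  assume "\<not> deriv \<omega> x \<le> 0"
  then obtain d where "d > 0" "\<forall>h>0. h < d \<longrightarrow> \<omega> x < \<omega> (x + h)"
    using DERIV_pos_inc_right[OF DERIV_omega[OF assms]] by force
  then have "\<omega> x < \<omega> (x + d / 2)" by simp
  then show False using omega_antimono[of x "x + d / 2"] assms \<open>d > 0\<close> by simp
qed

lemma weight_kappa: "weight \<kappa>"
proof -
  have "continuous_on UNIV (\<lambda>z::complex. deriv \<omega> ((cmod z)\<^sup>2))"
    by (rule continuous_on_compose2[OF continuous_deriv_omega]) (auto intro!: continuous_intros)
  then have "continuous_on UNIV \<kappa>"
    unfolding \<kappa>_def[abs_def] by (intro continuous_intros)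
  then show ?thesis
    using deriv_omega_nonpos by (simp add: weight_def borel_measurable_continuous_onI \<kappa>_def mult_le_0_iff)
qed

lemma radial_nu: "radial \<nu>" and radial_kappa: "radial \<kappa>"
  by (auto simp: radial_def \<nu>_def \<kappa>_def)

lemma nu_divide_le: "0 < s \<Longrightarrow> s \<le> t \<Longrightarrow> \<nu> (z / of_real s) \<le> \<nu> (z / of_real t)"
  by (simp add: \<nu>_def omega_antimono power_mono norm_divide frac_le)

lemma weight_Delta:
  assumes "0 < s" "s \<le> 1"
  shows "weight (\<Delta> s)"
proof -
  note [measurable] = weightD(1)[OF weight_nu]
  show ?thesis using nu_divide_le[OF assms] by (simp add: weight_def \<Delta>_def[abs_def])
qed

lemma rapidly_decreasing_nu:
  assumes "\<forall>n::int. ((\<lambda>r. r powi n * \<omega> (r\<^sup>2)) \<longlongrightarrow> 0) at_top"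
  shows "rapidly_decreasing \<nu>"
  unfolding rapidly_decreasing_def
proof
  fix m :: nat
  have "((\<lambda>r. r powi int m * \<omega> (r\<^sup>2)) \<longlongrightarrow> 0) at_top" using assms by blast
  then have "eventually (\<lambda>r. r powi int m * \<omega> (r\<^sup>2) < 1) at_top" by (rule order_tendstoD) simp
  then obtain R where R: "\<And>r. r \<ge> R \<Longrightarrow> r ^ m * \<omega> (r\<^sup>2) < 1"
    by (auto simp: eventually_at_top_linorder)
  have nonneg: "0 \<le> \<bar>R\<bar> ^ m * \<omega> 0" using omega_pos[of 0] by simp
  have "cmod z ^ m * \<nu> z \<le> 1 + \<bar>R\<bar> ^ m * \<omega> 0" for z
  proof (cases "R \<le> cmod z")
    case True
    then show ?thesis using R[of "cmod z"] nonneg by (simp add: \<nu>_def)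
  next
    case False
    then have "cmod z ^ m * \<nu> z \<le> \<bar>R\<bar> ^ m * \<omega> 0"
      using nu_pos[of z] by (intro mult_mono power_mono) (auto simp: \<nu>_def omega_antimono)
    then show ?thesis by simp
  qed
  then show "\<exists>C. \<forall>z. cmod z ^ m * \<nu> z \<le> C" by blast
qed

lemma DERIV_nu_divide:
  assumes "t > 0"
  shows "((\<lambda>t. \<nu> (z / of_real t)) has_real_derivative 2 / t * \<kappa> (z / of_real t)) (at t)"
proof -
  have "((\<lambda>t. \<omega> ((cmod z)\<^sup>2 / t\<^sup>2)) has_real_derivative
      deriv \<omega> ((cmod z)\<^sup>2 / t\<^sup>2) * (- 2 * (cmod z)\<^sup>2 / t ^ 3)) (at t)"
    by (rule DERIV_chain2[OF DERIV_omega])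
       (use assms in \<open>auto intro!: derivative_eq_intros
          simp: field_simps power2_eq_square power3_eq_cube power4_eq_xxxx\<close>)
  also have "(\<lambda>t. \<omega> ((cmod z)\<^sup>2 / t\<^sup>2)) = (\<lambda>t. \<nu> (z / of_real t))"
    by (simp add: \<nu>_def norm_divide power_divide)
  also have "deriv \<omega> ((cmod z)\<^sup>2 / t\<^sup>2) * (- 2 * (cmod z)\<^sup>2 / t ^ 3) = 2 / t * \<kappa> (z / of_real t)"
    by (simp add: \<kappa>_def norm_divide power_divide power2_eq_square power3_eq_cube mult_ac)
  finally show ?thesis .
qed

lemma Delta_quotient_tendsto: "((\<lambda>s. \<Delta> s z / (1 - s)) \<longlongrightarrow> 2 * \<kappa> z) (at_left 1)"
  using DERIV_left_quotient[OF DERIV_nu_divide[of 1 z]] by (simp add: \<Delta>_def)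

lemma Delta_eq_nn_integral:
  assumes "0 < s" "s \<le> 1"
  shows "ennreal (\<Delta> s z) = (\<integral>\<^sup>+t. ennreal (2 / t) * ennreal (\<kappa> (z / of_real t)) * indicator {s..1} t \<partial>lborel)"
proof -
  note [measurable] = weightD(1)[OF weight_kappa]
  have "ennreal (\<Delta> s z) = (\<integral>\<^sup>+t. ennreal (2 / t * \<kappa> (z / of_real t)) * indicator {s..1} t \<partial>lborel)"
    using assms DERIV_nu_divide
    by (subst nn_integral_FTC_Icc[of "\<lambda>t. 2 / t * \<kappa> (z / of_real t)" s 1 "\<lambda>t. \<nu> (z / of_real t)"])
       (simp_all add: \<Delta>_def weightD(2)[OF weight_kappa])
  also have "\<dots> = (\<integral>\<^sup>+t. ennreal (2 / t) * ennreal (\<kappa> (z / of_real t)) * indicator {s..1} t \<partial>lborel)"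
    using assms by (intro nn_integral_cong)
      (auto simp: weightD(2)[OF weight_kappa] split: split_indicator simp flip: ennreal_mult)
  finally show ?thesis .
qed

lemma nn_integral_norm_powr_Delta:
  assumes g: "g \<in> borel_measurable borel" and s: "0 < s" "s \<le> 1"
  shows "(\<integral>\<^sup>+z. ennreal (norm (g z) powr p * \<Delta> s z) \<partial>lborel)
    = (\<integral>\<^sup>+t. ennreal (2 / t) *
        (\<integral>\<^sup>+z. ennreal (norm (g z) powr p * \<kappa> (z / of_real t)) \<partial>lborel) * indicator {s..1} t \<partial>lborel)"
proof -
  note [measurable] = g weightD(1)[OF weight_kappa]
  have "(\<integral>\<^sup>+z. ennreal (norm (g z) powr p * \<Delta> s z) \<partial>lborel) = (\<integral>\<^sup>+z. \<integral>\<^sup>+t. ennreal (norm (g z) powr p) *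
      (ennreal (2 / t) * ennreal (\<kappa> (z / of_real t)) * indicator {s..1} t) \<partial>lborel \<partial>lborel)"
    by (simp add: ennreal_mult' Delta_eq_nn_integral[OF s] nn_integral_cmult)
  also have "\<dots> = (\<integral>\<^sup>+t. \<integral>\<^sup>+z. ennreal (norm (g z) powr p) *
      (ennreal (2 / t) * ennreal (\<kappa> (z / of_real t)) * indicator {s..1} t) \<partial>lborel \<partial>lborel)"
    by (rule lborel_pair.Fubini') (simp add: split_beta')
  also have "\<dots> = (\<integral>\<^sup>+t. \<integral>\<^sup>+z. ennreal (2 / t) * indicator {s..1} t *
      ennreal (norm (g z) powr p * \<kappa> (z / of_real t)) \<partial>lborel \<partial>lborel)"
    by (simp add: ennreal_mult' mult_ac)
  also have "\<dots> = (\<integral>\<^sup>+t. ennreal (2 / t) *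
      (\<integral>\<^sup>+z. ennreal (norm (g z) powr p * \<kappa> (z / of_real t)) \<partial>lborel) * indicator {s..1} t \<partial>lborel)"
    by (simp add: nn_integral_cmult mult_ac)
  finally show ?thesis .
qed

lemma Ap_mass_Delta_le:
  assumes g: "g \<in> Ap_space p \<kappa>" and p: "p > 1" and s: "0 < s" "s \<le> 1"
  shows "Ap_mass p (\<Delta> s) g \<le> (1 - s\<^sup>2) * Ap_mass p \<kappa> g"
proof (rule Ap_space_nn_integral_le(2)[OF weight_Delta[OF s] Ap_spaceD(1)[OF g]])
  define D where "D = Ap_mass p \<kappa> g"
  have D: "0 \<le> D" unfolding D_def by (rule Ap_mass_nonneg[OF weight_kappa])
  show "0 \<le> (1 - s\<^sup>2) * Ap_mass p \<kappa> g"
    using s D by (simp add: D_def power_le_one)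
  have "ennreal (2 / t) *
        (\<integral>\<^sup>+z. ennreal (norm (g z) powr p * \<kappa> (z / of_real t)) \<partial>lborel) * indicator {s..1} t
      \<le> ennreal (2 * t * D) * indicator {s..1} t" for t
  proof (cases "t \<in> {s..1}")
    case True
    then have t: "0 < t" "t \<le> 1" using s by auto
    have "ennreal (2 / t) * (\<integral>\<^sup>+z. ennreal (norm (g z) powr p * \<kappa> (z / of_real t)) \<partial>lborel)
        \<le> ennreal (2 / t) * ennreal (t\<^sup>2 * D)"
      unfolding D_def
      by (intro mult_left_mono nn_integral_weight_dilate_le g p t weight_kappa radial_kappa) auto
    also have "\<dots> = ennreal (2 * t * D)"
      using t D by (subst ennreal_mult[symmetric]) (auto simp: power2_eq_square)
    finally show ?thesis using True by simp
  qed simp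
  then have "(\<integral>\<^sup>+z. ennreal (norm (g z) powr p * \<Delta> s z) \<partial>lborel)
      \<le> (\<integral>\<^sup>+t. ennreal (2 * t * D) * indicator {s..1} t \<partial>lborel)"
    unfolding nn_integral_norm_powr_Delta[OF Ap_spaceD(2)[OF g] s] by (rule nn_integral_mono)
  also have "\<dots> = ennreal (1\<^sup>2 * D - s\<^sup>2 * D)"
    using s D by (intro nn_integral_FTC_Icc) (auto intro!: derivative_eq_intros)
  finally show "(\<integral>\<^sup>+z. ennreal (norm (g z) powr p * \<Delta> s z) \<partial>lborel) \<le> ennreal ((1 - s\<^sup>2) * Ap_mass p \<kappa> g)"
    by (simp add: D_def algebra_simps)
qed

lemma nn_integral_kappa_le_liminf:
  assumes g: "g \<in> borel_measurable borel" and r: "filterlim r (at_left 1) sequentially"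
  shows "(\<integral>\<^sup>+z. ennreal (norm (g z) powr p * \<kappa> z) \<partial>lborel)
    \<le> liminf (\<lambda>n. \<integral>\<^sup>+z. ennreal (norm (g z) powr p * \<Delta> (r n) z / (2 * (1 - r n))) \<partial>lborel)"
proof -
  note [measurable] = g weightD(1)[OF weight_nu]
  have "(\<lambda>n. ennreal (norm (g z) powr p * \<Delta> (r n) z / (2 * (1 - r n))))
      \<longlonglongrightarrow> ennreal (norm (g z) powr p * \<kappa> z)" for z
  proof -
    have "(\<lambda>n. norm (g z) powr p * (\<Delta> (r n) z / (1 - r n)) / 2) \<longlonglongrightarrow> norm (g z) powr p * (2 * \<kappa> z) / 2"
      by (intro tendsto_intros filterlim_compose[OF Delta_quotient_tendsto r]) simp
    then show ?thesis by (intro tendsto_ennrealI) (simp add: mult.commute)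
  qed
  then have "(\<integral>\<^sup>+z. ennreal (norm (g z) powr p * \<kappa> z) \<partial>lborel)
      = (\<integral>\<^sup>+z. liminf (\<lambda>n. ennreal (norm (g z) powr p * \<Delta> (r n) z / (2 * (1 - r n)))) \<partial>lborel)"
    by (intro nn_integral_cong lim_imp_Liminf[symmetric]) auto
  also have "\<dots> \<le> liminf (\<lambda>n. \<integral>\<^sup>+z. ennreal (norm (g z) powr p * \<Delta> (r n) z / (2 * (1 - r n))) \<partial>lborel)"
    unfolding \<Delta>_def by (rule nn_integral_liminf) measurable
  finally show ?thesis .
qed

context
  fixes p :: real and g :: "complex \<Rightarrow> complex"
  assumes p: "p > 1" and g: "g \<in> Ap_space p \<nu>"
begin

lemma Ap_space_Delta:
  assumes "0 < s" "s \<le> 1"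
  shows "g \<in> Ap_space p (\<Delta> s)"
  by (rule Ap_space_weight_mono(1)[OF weight_Delta[OF assms] _ g]) (simp add: \<Delta>_def nu_pos less_imp_le)

lemma Ap_mass_Delta:
  assumes s: "0 < s" "s \<le> 1"
  shows "Ap_mass p (\<Delta> s) g = Ap_mass p \<nu> g - s\<^sup>2 * Ap_mass p \<nu> (\<lambda>z. g (of_real s * z))"
  using Ap_mass_weight_diff[OF g Ap_space_weight_dilate[OF g p s weight_nu radial_nu]]
  by (simp add: \<Delta>_def[abs_def] Ap_mass_dilate[OF weight_nu Ap_spaceD(1)[OF g] s(1)])

lemma Ap_mass_Delta_ge:
  assumes s: "0 < s" "s \<le> 1"
  shows "(1 - s\<^sup>2) * Ap_mass p \<nu> g \<le> Ap_mass p (\<Delta> s) g"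
  using mult_left_mono[OF Ap_space_dilate(2)[OF g p _ s(2) weight_nu radial_nu], of "s\<^sup>2"] s
  by (simp add: Ap_mass_Delta[OF s] algebra_simps)

lemma Ap_mass_Delta_antimono:
  assumes s: "0 < s" "s \<le> t" "t \<le> 1"
  shows "Ap_mass p (\<Delta> t) g \<le> Ap_mass p (\<Delta> s) g"
  by (rule Ap_space_weight_mono(2)[OF weight_Delta _ Ap_space_Delta])
     (use s nu_divide_le[OF s(1,2)] in \<open>auto simp: \<Delta>_def\<close>)

lemma Ap_mass_kappa_le_quotient_limit:
  assumes bound: "eventually (\<lambda>r. Ap_mass p (\<Delta> r) g / (1 - r) \<le> y r) (at_left 1)"
    and y: "(y \<longlongrightarrow> Y) (at_left 1)"
  shows "g \<in> Ap_space p \<kappa>" and "2 * Ap_mass p \<kappa> g \<le> Y"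
proof -
  define r where "r n = 1 - 1 / real (Suc (Suc n))" for n
  have r: "0 < r n" "r n < 1" for n by (auto simp: r_def field_simps)
  have "r \<longlonglongrightarrow> 1 - 0"
    unfolding r_def by (intro tendsto_intros LIMSEQ_Suc lim_1_over_n)
  then have r_lim: "filterlim r (at_left 1) sequentially"
    using r by (intro tendsto_imp_filterlim_at_left) auto
  have le_y: "eventually (\<lambda>n. Ap_mass p (\<Delta> (r n)) g / (1 - r n) \<le> y (r n)) sequentially"
    by (rule eventually_compose_filterlim[OF bound r_lim])
  have y_lim: "(\<lambda>n. y (r n)) \<longlonglongrightarrow> Y" by (rule filterlim_compose[OF y r_lim])
  have "0 \<le> Ap_mass p (\<Delta> (r n)) g / (1 - r n)" for n
    using r[of n] by (intro divide_nonneg_pos Ap_mass_nonneg weight_Delta) auto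
  then have "0 \<le> Y"
    using le_y by (intro tendsto_lowerbound[OF y_lim]) (auto elim!: eventually_mono intro: order_trans)
  have mass: "(\<integral>\<^sup>+z. ennreal (norm (g z) powr p * \<Delta> (r n) z / (2 * (1 - r n))) \<partial>lborel)
      = ennreal (Ap_mass p (\<Delta> (r n)) g / (1 - r n) / 2)" for n
    using r[of n] Ap_spaceD(3)[OF Ap_space_Delta, of "r n"] weightD(2)[OF weight_Delta, of "r n"]
    by (subst nn_integral_eq_integral) (auto simp: Ap_mass_def mult.commute)
  have "(\<integral>\<^sup>+z. ennreal (norm (g z) powr p * \<kappa> z) \<partial>lborel)
      \<le> liminf (\<lambda>n. ennreal (Ap_mass p (\<Delta> (r n)) g / (1 - r n) / 2))"
    using nn_integral_kappa_le_liminf[OF Ap_spaceD(2)[OF g] r_lim, of p] by (simp only: mass)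
  also have "\<dots> \<le> liminf (\<lambda>n. ennreal (y (r n) / 2))"
    using le_y by (intro Liminf_mono, eventually_elim) (intro ennreal_leI divide_right_mono, auto)
  also have "\<dots> = ennreal (Y / 2)"
    by (intro lim_imp_Liminf tendsto_ennrealI tendsto_divide y_lim tendsto_const) auto
  finally have "(\<integral>\<^sup>+z. ennreal (norm (g z) powr p * \<kappa> z) \<partial>lborel) \<le> ennreal (Y / 2)" .
  from Ap_space_nn_integral_le[OF weight_kappa Ap_spaceD(1)[OF g] _ this] \<open>0 \<le> Y\<close>
  show "g \<in> Ap_space p \<kappa>" "2 * Ap_mass p \<kappa> g \<le> Y" by auto
qed

end

end

section \<open>Passage to the limit\<close>

lemma powr_inverse_le_tangent:
  fixes x p :: real
  assumes "0 \<le> x" "1 < p"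
  shows "x powr (1 / p) \<le> 1 - (1 - x) / p"
proof -
  have "x powr (1 / p) * 1 \<le> (x powr (1 / p)) powr p / p + 1 powr (p / (p - 1)) / (p / (p - 1))"
    using assms by (intro Youngs_inequality) (auto simp: field_simps)
  also have "\<dots> = 1 - (1 - x) / p"
    using assms by (simp add: powr_powr field_simps)
  finally show ?thesis by simp
qed

lemma le_of_le_mult_one_plus_powr:
  fixes x K p q :: real
  assumes pq: "1 < p" "1 < q" "1 / p + 1 / q = 1" and "0 \<le> x" "0 \<le> K" "x \<le> K * (1 + x powr (1 / p))"
  shows "x \<le> 1 + (2 * K) powr q"
proof (cases "x \<le> 1")
  case False
  then have "1 \<le> x powr (1 / p)" using pq by (intro ge_one_powr_ge_zero) auto
  then have "K * (1 + x powr (1 / p)) \<le> K * (2 * x powr (1 / p))"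
    using assms by (intro mult_left_mono) auto
  moreover have "x powr (1 / p) * x powr (1 / q) = x"
    using False pq by (simp flip: powr_add)
  ultimately have "x powr (1 / p) * x powr (1 / q) \<le> x powr (1 / p) * (2 * K)"
    using assms(6) by (simp add: mult_ac)
  then have "x powr (1 / q) \<le> 2 * K" using False by (simp add: mult_le_cancel_left)
  then have "(x powr (1 / q)) powr q \<le> (2 * K) powr q" using pq by (intro powr_mono2) auto
  then show ?thesis using pq False by (simp add: powr_powr)
qed (auto intro: order_trans)

lemma powr_le_of_self_bound:
  fixes D m p :: real
  assumes p: "1 < p" and "1 \<le> D" "0 \<le> m" and self_bound: "2 * D + (p - 2) \<le> p * (m * D powr (1 / p))"
  shows "D powr (1 / p) \<le> (max (p - 1) 1 * m) powr (1 / (p - 1))"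
proof -
  have "D \<le> max (p - 1) 1 * m * D powr (1 / p)"
  proof (cases "p \<ge> 2")
    case True
    then have "2 * D \<le> p * (m * D powr (1 / p))" using self_bound by simp
    also have "\<dots> \<le> (2 * (p - 1)) * (m * D powr (1 / p))"
      using True \<open>0 \<le> m\<close> by (intro mult_right_mono) auto
    finally show ?thesis using True by (simp add: algebra_simps)
  next
    case False
    then have "p * D \<le> 2 * D + (p - 2)"
      using mult_left_mono[OF \<open>1 \<le> D\<close>, of "2 - p"] by (simp add: algebra_simps)
    with self_bound have "p * D \<le> p * (m * D powr (1 / p))" by linarith
    then show ?thesis using p False by simp
  qed
  moreover have "D powr (1 / p) * D powr (1 - 1 / p) = D"
    using \<open>1 \<le> D\<close> by (simp flip: powr_add)
  ultimately have "D powr (1 / p) * D powr (1 - 1 / p) \<le> D powr (1 / p) * (max (p - 1) 1 * m)"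
    by (simp add: mult_ac)
  then have "D powr (1 - 1 / p) \<le> max (p - 1) 1 * m"
    using \<open>1 \<le> D\<close> by (simp add: mult_le_cancel_left)
  then have "(D powr (1 - 1 / p)) powr (1 / (p - 1)) \<le> (max (p - 1) 1 * m) powr (1 / (p - 1))"
    using p by (intro powr_mono2) auto
  moreover have "(1 - 1 / p) * (1 / (p - 1)) = 1 / p" using p by (simp add: field_simps)
  ultimately show ?thesis by (simp only: powr_powr)
qed

lemma powr_quotient_at_left_1:
  fixes a c :: real
  shows "((\<lambda>r. (1 - r powr a) / (1 - r)) \<longlongrightarrow> a) (at_left 1)"
    and "((\<lambda>r. c / r powr a) \<longlongrightarrow> c) (at_left 1)"
proof -
  show "((\<lambda>r. (1 - r powr a) / (1 - r)) \<longlongrightarrow> a) (at_left 1)"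
    using DERIV_left_quotient[OF has_real_derivative_powr[of 1 a]] by simp
  have "((\<lambda>r. c / r powr a) \<longlongrightarrow> c / 1 powr a) (at_left 1)"
    by (intro tendsto_intros) auto
  then show "((\<lambda>r. c / r powr a) \<longlongrightarrow> c) (at_left 1)" by simp
qed

lemma eventually_at_left_1_unit_interval: "eventually (\<lambda>r::real. 0 < r \<and> r < 1) (at_left 1)"
  by (auto simp: eventually_at_left_field intro: exI[of _ 0])

locale radial_extremal =
  smooth_radial_weight \<omega> + extremal_problem p q "smooth_radial_weight.\<nu> \<omega>" k f
  for \<omega> :: "real \<Rightarrow> real" and p q k f
begin

lemma extremal_dilation_bound:
  assumes s: "0 < s" "s \<le> 1"
  shows "dual_norm p \<nu> k * (1 - s\<^sup>2 * Ap_norm p \<nu> (\<lambda>z. f (of_real (s\<^sup>2) * z)))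
    \<le> Ap_norm p (\<Delta> s) f * Ap_norm q (\<Delta> s) k"
proof -
  let ?f = "\<lambda>z. f (of_real (s\<^sup>2) * z)"
  note dilate = Ap_space_weight_dilate[OF _ _ s weight_nu radial_nu]
  have "?f \<in> Ap_space p \<nu>"
    using s by (intro Ap_space_dilate f_space p weight_nu radial_nu) (auto simp: power_le_one)
  then have "s\<^sup>2 * Re (Phi \<nu> k ?f) \<le> s\<^sup>2 * (dual_norm p \<nu> k * Ap_norm p \<nu> ?f)"
    by (intro mult_left_mono order_trans[OF complex_Re_le_cmod norm_Phi_le_dual_norm]) auto
  moreover have "Phi \<nu> k f - of_real (s\<^sup>2) * Phi \<nu> k ?f = Phi (\<Delta> s) k f"
    unfolding Phi_dilate_eq_Phi_weight[OF conjugate_exponents weight_nu radial_nu f_space k s] \<Delta>_def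
    by (intro Phi_weight_diff[symmetric] Phi_Holder(1)[OF conjugate_exponents] dilate weight_divide weight_nu
          f_space k conjugate_exponents)
  then have "dual_norm p \<nu> k - s\<^sup>2 * Re (Phi \<nu> k ?f) = Re (Phi (\<Delta> s) k f)"
    by (simp add: dual_norm_eq complex_eq_iff del: of_real_power)
  moreover have "Re (Phi (\<Delta> s) k f) \<le> Ap_norm p (\<Delta> s) f * Ap_norm q (\<Delta> s) k"
    using conjugate_exponents s
    by (intro order_trans[OF complex_Re_le_cmod] Phi_Holder(2)[OF conjugate_exponents] weight_Delta
          Ap_space_Delta f_space k)
  ultimately show ?thesis by (simp add: algebra_simps)
qed

lemma Ap_norm_dilate_le:
  assumes r: "0 < r" "r \<le> 1"
  shows "r * Ap_norm p \<nu> (\<lambda>z. f (of_real r * z)) \<le> r powr (1 - 2 / p) * (1 - Ap_mass p (\<Delta> r) f / p)"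
proof -
  define I where "I = Ap_mass p \<nu> (\<lambda>z. f (of_real r * z))"
  have mass: "Ap_mass p (\<Delta> r) f = 1 - r\<^sup>2 * I"
    by (simp add: Ap_mass_Delta[OF p f_space r] I_def Ap_mass_f)
  have "0 \<le> I" unfolding I_def by (rule Ap_mass_nonneg[OF weight_nu])
  have "r = r powr (1 - 2 / p) * (r\<^sup>2) powr (1 / p)"
    using r by (simp add: powr_powr flip: powr_add powr_numeral)
  then have "r * I powr (1 / p) = r powr (1 - 2 / p) * ((r\<^sup>2) powr (1 / p) * I powr (1 / p))"
    by (metis mult.assoc)
  also have "\<dots> = r powr (1 - 2 / p) * (r\<^sup>2 * I) powr (1 / p)"
    using \<open>0 \<le> I\<close> by (simp add: powr_mult)
  also have "\<dots> \<le> r powr (1 - 2 / p) * (1 - (1 - r\<^sup>2 * I) / p)"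
    using \<open>0 \<le> I\<close> by (intro mult_left_mono powr_inverse_le_tangent p) auto
  finally show ?thesis by (simp add: Ap_norm_eq_Ap_mass_powr mass flip: I_def)
qed

lemma extremal_increment_le:
  assumes k_kappa: "k \<in> Ap_space q \<kappa>" and r: "0 < r" "r < 1"
    and quotient_le: "Ap_mass p (\<Delta> (sqrt r)) f / (1 - r) \<le> t"
  shows "dual_norm p \<nu> k * (1 - r powr (1 - 2 / p) * (1 - Ap_mass p (\<Delta> r) f / p))
    \<le> (1 - r) * (t powr (1 / p) * Ap_norm q \<kappa> k)"
proof -
  have s: "0 < sqrt r" "sqrt r \<le> 1" "(sqrt r)\<^sup>2 = r" using r by auto
  have mass_k: "Ap_mass q (\<Delta> (sqrt r)) k \<le> (1 - r) * Ap_mass q \<kappa> k"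
    using Ap_mass_Delta_le[OF k_kappa conjugate_exponents(2) s(1,2)] s(3) by simp
  have mass_f: "Ap_mass p (\<Delta> (sqrt r)) f \<le> (1 - r) * t"
    using quotient_le r by (simp add: pos_divide_le_eq mult.commute)
  note mass_nonneg = Ap_mass_nonneg[OF weight_Delta[OF s(1,2)]]
  have "0 \<le> t"
    using order_trans[OF divide_nonneg_pos[OF mass_nonneg] quotient_le] r by simp
  have "dual_norm p \<nu> k * (1 - r powr (1 - 2 / p) * (1 - Ap_mass p (\<Delta> r) f / p))
      \<le> dual_norm p \<nu> k * (1 - r * Ap_norm p \<nu> (\<lambda>z. f (of_real r * z)))"
    using Ap_norm_dilate_le[of r] r dual_norm_nonneg by (intro mult_left_mono) auto
  also have "\<dots> \<le> Ap_norm p (\<Delta> (sqrt r)) f * Ap_norm q (\<Delta> (sqrt r)) k"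
    using extremal_dilation_bound[OF s(1,2)] s(3) by simp
  also have "\<dots> \<le> ((1 - r) * t) powr (1 / p) * ((1 - r) * Ap_mass q \<kappa> k) powr (1 / q)"
    unfolding Ap_norm_eq_Ap_mass_powr using mass_f mass_k conjugate_exponents
    by (intro mult_mono powr_mono2 mass_nonneg) auto
  also have "\<dots> = ((1 - r) powr (1 / p) * (1 - r) powr (1 / q)) * (t powr (1 / p) * Ap_norm q \<kappa> k)"
    using r \<open>0 \<le> t\<close> by (simp add: powr_mult Ap_mass_nonneg weight_kappa Ap_norm_eq_Ap_mass_powr)
  also have "(1 - r) powr (1 / p) * (1 - r) powr (1 / q) = 1 - r"
    using r conjugate_exponents(3) by (simp flip: powr_add)
  finally show ?thesis .
qed

context
  assumes k_kappa: "k \<in> Ap_space q \<kappa>" and pos: "0 < dual_norm p \<nu> k"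
begin

lemma extremal_quotient_le:
  assumes r: "0 < r" "r < 1" and quotient_le: "Ap_mass p (\<Delta> (sqrt r)) f / (1 - r) \<le> t"
  shows "Ap_mass p (\<Delta> r) f / (1 - r)
    \<le> p / r powr (1 - 2 / p) *
       (Ap_norm q \<kappa> k / dual_norm p \<nu> k * t powr (1 / p) - (1 - r powr (1 - 2 / p)) / (1 - r))"
proof -
  define \<rho> where "\<rho> = r powr (1 - 2 / p)"
  have "\<rho> > 0" using r by (simp add: \<rho>_def)
  have "1 - \<rho> * (1 - Ap_mass p (\<Delta> r) f / p) \<le> (1 - r) * (Ap_norm q \<kappa> k / dual_norm p \<nu> k * t powr (1 / p))"
    using extremal_increment_le[OF k_kappa r quotient_le] pos
    by (simp add: pos_le_divide_eq mult_ac flip: \<rho>_def)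
  then have "\<rho> / p * Ap_mass p (\<Delta> r) f
      \<le> (1 - r) * (Ap_norm q \<kappa> k / dual_norm p \<nu> k * t powr (1 / p)) - (1 - \<rho>)"
    by (simp add: algebra_simps)
  then have "\<rho> / p * (Ap_mass p (\<Delta> r) f / (1 - r))
      \<le> Ap_norm q \<kappa> k / dual_norm p \<nu> k * t powr (1 / p) - (1 - \<rho>) / (1 - r)"
    using r divide_right_mono[of _ _ "1 - r"] by (fastforce simp: diff_divide_distrib)
  from mult_left_mono[OF this, of "p / \<rho>"] show ?thesis
    using \<open>\<rho> > 0\<close> p by (simp flip: \<rho>_def)
qed

text \<open>Since \<open>\<Delta>\<close> decreases in its first argument, the quotient \<open>x\<close> of the mass of \<open>f\<close> for \<open>\<Delta> r\<close> by \<open>1 - r\<close>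
  satisfies \<open>x \<le> K (1 + x\<^bsup>1/p\<^esup>)\<close> near \<open>r = 1\<close> and is therefore bounded.\<close>

lemma extremal_in_Ap_space_kappa: "f \<in> Ap_space p \<kappa>"
proof (rule Ap_mass_kappa_le_quotient_limit(1)[OF p f_space _ tendsto_const])
  define m where "m = Ap_norm q \<kappa> k / dual_norm p \<nu> k"
  define K where "K = 2 * p * (m + 1)"
  have m: "0 \<le> m" using pos by (simp add: m_def Ap_norm_def)
  have "eventually (\<lambda>r. p / r powr (1 - 2 / p) < 2 * p) (at_left 1)"
    using p by (intro order_tendstoD(2)[OF powr_quotient_at_left_1(2)]) auto
  moreover have "eventually (\<lambda>r. - 1 < (1 - r powr (1 - 2 / p)) / (1 - r)) (at_left 1)"
    using p by (intro order_tendstoD(1)[OF powr_quotient_at_left_1(1)]) (auto simp: field_simps)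
  ultimately show "eventually (\<lambda>r. Ap_mass p (\<Delta> r) f / (1 - r) \<le> 1 + (2 * K) powr q) (at_left 1)"
    using eventually_at_left_1_unit_interval
  proof eventually_elim
    case (elim r)
    define x where "x = Ap_mass p (\<Delta> r) f / (1 - r)"
    have "r \<le> sqrt r" using elim by (simp add: real_le_rsqrt power2_eq_square mult_left_le)
    then have "Ap_mass p (\<Delta> (sqrt r)) f / (1 - r) \<le> x"
      unfolding x_def using elim by (intro divide_right_mono Ap_mass_Delta_antimono[OF p f_space]) auto
    from extremal_quotient_le[OF _ _ this]
    have "x \<le> p / r powr (1 - 2 / p) * (m * x powr (1 / p) - (1 - r powr (1 - 2 / p)) / (1 - r))"
      using elim by (simp add: x_def m_def)
    also have "\<dots> \<le> p / r powr (1 - 2 / p) * (m * x powr (1 / p) + 1)"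
      using elim p by (intro mult_left_mono) auto
    also have "\<dots> \<le> 2 * p * (m * x powr (1 / p) + 1)"
      using elim m by (intro mult_right_mono) auto
    also have "\<dots> \<le> K * (1 + x powr (1 / p))"
      using p m by (simp add: K_def algebra_simps)
    finally have "x \<le> K * (1 + x powr (1 / p))" .
    moreover have "0 \<le> x"
      unfolding x_def using elim by (intro divide_nonneg_pos Ap_mass_nonneg weight_Delta) auto
    ultimately show ?case
      unfolding x_def[symmetric] using p m
      by (intro le_of_le_mult_one_plus_powr[OF conjugate_exponents]) (auto simp: K_def)
  qed
qed

lemma extremal_kappa_self_bound:
  "2 * Ap_mass p \<kappa> f + (p - 2)
    \<le> p * (Ap_norm q \<kappa> k / dual_norm p \<nu> k * Ap_mass p \<kappa> f powr (1 / p))"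
proof -
  define D where "D = Ap_mass p \<kappa> f"
  define m where "m = Ap_norm q \<kappa> k / dual_norm p \<nu> k"
  have "2 * D \<le> p * (m * D powr (1 / p) - (1 - 2 / p))"
    unfolding D_def
  proof (rule Ap_mass_kappa_le_quotient_limit(2)[OF p f_space])
    show "eventually (\<lambda>r. Ap_mass p (\<Delta> r) f / (1 - r) \<le> p / r powr (1 - 2 / p) *
        (m * Ap_mass p \<kappa> f powr (1 / p) - (1 - r powr (1 - 2 / p)) / (1 - r))) (at_left 1)"
      using eventually_at_left_1_unit_interval
    proof eventually_elim
      case (elim r)
      have "Ap_mass p (\<Delta> (sqrt r)) f \<le> (1 - (sqrt r)\<^sup>2) * Ap_mass p \<kappa> f"
        using elim by (intro Ap_mass_Delta_le[OF extremal_in_Ap_space_kappa p]) auto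
      then have "Ap_mass p (\<Delta> (sqrt r)) f / (1 - r) \<le> Ap_mass p \<kappa> f"
        using elim by (simp add: pos_divide_le_eq mult.commute)
      then show ?case
        unfolding m_def using elim by (intro extremal_quotient_le) auto
    qed
    show "((\<lambda>r. p / r powr (1 - 2 / p) *
          (m * Ap_mass p \<kappa> f powr (1 / p) - (1 - r powr (1 - 2 / p)) / (1 - r)))
        \<longlongrightarrow> p * (m * Ap_mass p \<kappa> f powr (1 / p) - (1 - 2 / p))) (at_left 1)"
      by (intro tendsto_intros powr_quotient_at_left_1)
  qed
  then show ?thesis using p by (simp add: D_def m_def algebra_simps)
qed

lemma extremal_kappa_ge_1: "1 \<le> Ap_mass p \<kappa> f"
  using Ap_mass_Delta_ge[OF p f_space, of "1 / 2"]
    Ap_mass_Delta_le[OF extremal_in_Ap_space_kappa p, of "1 / 2"]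
  by (simp add: Ap_mass_f power2_eq_square)

lemma extremal_Ap_norm_kappa_le:
  "Ap_norm p \<kappa> f \<le> (max (p - 1) 1 / dual_norm p \<nu> k * Ap_norm q \<kappa> k) powr (1 / (p - 1))"
  using powr_le_of_self_bound[OF p extremal_kappa_ge_1 _ extremal_kappa_self_bound] pos
  by (simp add: Ap_norm_eq_Ap_mass_powr)

end

end

theorem theorem3p1:
  fixes p q phat :: real and \<omega> :: "real \<Rightarrow> real" and k f :: "complex \<Rightarrow> complex"
  assumes p: "1 < p" and q: "q = p / (p - 1)" and phat: "phat = max (p - 1) 1"
    and an: "analytic_near_halfline \<omega>"
    and pos: "\<forall>x\<ge>0. \<omega> x > 0"
    and noninc: "\<forall>x y. 0 \<le> x \<longrightarrow> x \<le> y \<longrightarrow> \<omega> y \<le> \<omega> x"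
    and noncst: "\<exists>x y. 0 \<le> x \<and> 0 \<le> y \<and> \<omega> x \<noteq> \<omega> y"
    and lim1: "\<forall>n::int. ((\<lambda>r. r powi n * \<omega> (r^2)) \<longlongrightarrow> 0) at_top"
    and lim2: "\<forall>n::int. ((\<lambda>r. r powi n * deriv \<omega> (r^2)) \<longlongrightarrow> 0) at_top"
    and dense1: "polys_dense p (\<lambda>z. \<omega> ((cmod z)^2))"
    and dense2: "polys_dense q (\<lambda>z. \<omega> ((cmod z)^2) - (cmod z)^2 * deriv \<omega> ((cmod z)^2))"
    and k: "k \<in> Ap_space q (\<lambda>z. \<omega> ((cmod z)^2))" and knz: "k \<noteq> (\<lambda>z. 0)"
    and f: "is_extremal p (\<lambda>z. \<omega> ((cmod z)^2)) k f"
  shows "integrable lborel (D_integrand \<omega> q k) \<longrightarrow>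
           integrable lborel (D_integrand \<omega> p f) \<and>
           D_inf \<omega> p f \<le>
             (phat / dual_norm p (\<lambda>z. \<omega> ((cmod z)^2)) k * D_inf \<omega> q k) powr (1 / (p - 1))"
proof
  assume "integrable lborel (D_integrand \<omega> q k)"
  interpret smooth_radial_weight \<omega>
    using analytic_near_halfline_deriv[OF an] pos noninc by unfold_locales auto
  have \<nu>: "(\<lambda>z. \<omega> ((cmod z)\<^sup>2)) = \<nu>" by (simp add: \<nu>_def[abs_def])
  interpret radial_extremal \<omega> p q k f
    using p q k f weight_nu by unfold_locales (simp_all add: \<nu>)
  have D_integrand: "D_integrand \<omega> a g = (\<lambda>z. norm (g z) powr a * \<kappa> z)" for a g
    by (auto simp: D_integrand_def \<kappa>_def)
  then have D_inf: "D_inf \<omega> a g = Ap_norm a \<kappa> g" for a g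
    by (simp add: D_inf_def Ap_norm_def)
  have "k \<in> Ap_space q \<kappa>"
    using \<open>integrable lborel (D_integrand \<omega> q k)\<close> Ap_spaceD(1)[OF k] by (simp add: Ap_space_def D_integrand)
  moreover have "0 < dual_norm p \<nu> k"
    using knz by (intro dual_norm_pos radial_nu rapidly_decreasing_nu lim1 nu_pos)
  ultimately show "integrable lborel (D_integrand \<omega> p f) \<and>
      D_inf \<omega> p f \<le> (phat / dual_norm p (\<lambda>z. \<omega> ((cmod z)^2)) k * D_inf \<omega> q k) powr (1 / (p - 1))"
    using Ap_spaceD(3)[OF extremal_in_Ap_space_kappa] extremal_Ap_norm_kappa_le
    by (simp add: D_integrand D_inf \<nu> phat)
qed

end
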